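(* Let $K$ be a field, $\lambda\in K$. Let $(A,\mu,\Delta,\alpha_A,\beta_A,\psi_A,\omega_A)$ be a $\lambda$-infBH-bialgebra such that $\alpha_A,\beta_A,\psi_A,\omega_A$ are invertible, and let $(M,\triangleright,\triangleleft,\rho,\varphi,\alpha_M,\beta_M,\psi_M,\omega_M)$ be a $\lambda$-infBH-Hopf bimodule over it, where $\alpha_M,\beta_M,\psi_M,\omega_M$ are invertible. Write $\Delta(a)=a_1\otimes a_2$, $\rho(m)=m_{-1}\otimes m_0$, $\varphi(m)=m_{(0)}\otimes m_{(1)}$. For $a,b\in A$, $m\in M$ set $$a\star m=\big(\alpha_A^{-2}\beta_A\omega_A^{-1}(m_{-1})\,\beta_A^{-1}(a)\big)\triangleright\psi_M^{-1}(m_0)+\big(\alpha_M^{-2}\beta_M\omega_M^{-1}(m_{(0)})\triangleleft\beta_A^{-1}(a)\big)\triangleleft\psi_A^{-1}(m_{(1)}),$$ $$m\star a=\big(\alpha_A^{-2}\beta_A\omega_A^{-1}(a_1)\triangleright\beta_M^{-1}(m)\big)\triangleleft\psi_A^{-1}(a_2),\qquad a\star b=\big(\alpha_A^{-2}\beta_A\omega_A^{-1}(b_1)\,\beta_A^{-1}(a)\big)\psi_A^{-1}(b_2).$$ Then $(M,\star,\alpha_M,\beta_M)$ is a BiHom-pre-Lie bimodule over the BiHom-pre-Lie algebra $(A,\star,\alpha_A,\beta_A)$.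
   Context: Everything is over the field $K$; (co)units are not assumed. BiHom-associative algebra $(A,\mu,\alpha,\beta)$: $\mu$ (written $ab$) and $\alpha,\beta$ linear, $\alpha\beta=\beta\alpha$, $\alpha,\beta$ multiplicative, $\alpha(a)(bc)=(ab)\beta(c)$. BiHom-coassociative coalgebra $(C,\Delta,\psi,\omega)$: $\psi\omega=\omega\psi$, $(\psi\otimes\psi)\Delta=\Delta\psi$, $(\omega\otimes\omega)\Delta=\Delta\omega$, $(\Delta\otimes\psi)\Delta=(\omega\otimes\Delta)\Delta$. $\lambda$-infBH-bialgebra ($\lambda$-infinitesimal BiHom-bialgebra) $(A,\mu,\Delta,\alpha,\beta,\psi,\omega)$: $(A,\mu,\alpha,\beta)$ BiHom-associative, $(A,\Delta,\psi,\omega)$ BiHom-coassociative, each of $\alpha,\beta$ commutes with each of $\psi,\omega$, $(\alpha\otimes\alpha)\Delta=\Delta\alpha$, $(\beta\otimes\beta)\Delta=\Delta\beta$, $\psi,\omega$ multiplicative, and $\Delta(ab)=\omega(a)b_1\otimes\beta(b_2)+\alpha(a_1)\otimes a_2\psi(b)+\lambda\,\alpha\omega(a)\otimes\beta\psi(b)$. Bimodule $(M,\triangleright,\triangleleft,\alpha_M,\beta_M)$ over $(A,\mu,\alpha_A,\beta_A)$: $\alpha_M\beta_M=\beta_M\alpha_M$; $f_M(a\triangleright m)=f_A(a)\triangleright f_M(m)$, $f_M(m\triangleleft a)=f_M(m)\triangleleft f_A(a)$ for $f\in\{\alpha,\beta\}$; $\alpha_A(a)\triangleright(a'\triangleright m)=(aa')\triangleright\beta_M(m)$;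 $\alpha_M(m)\triangleleft(aa')=(m\triangleleft a)\triangleleft\beta_A(a')$; $\alpha_A(a)\triangleright(m\triangleleft a')=(a\triangleright m)\triangleleft\beta_A(a')$. Bicomodule $(M,\rho,\varphi,\psi_M,\omega_M)$ over $(A,\Delta,\psi_A,\omega_A)$, $\rho:M\to A\otimes M$, $\varphi:M\to M\otimes A$: $\psi_M\omega_M=\omega_M\psi_M$; $(g_A\otimes g_M)\rho=\rho g_M$, $(g_M\otimes g_A)\varphi=\varphi g_M$ for $g\in\{\psi,\omega\}$; $(\omega_A\otimes\rho)\rho=(\Delta\otimes\psi_M)\rho$; $(\omega_M\otimes\Delta)\varphi=(\varphi\otimes\psi_A)\varphi$; $(\omega_A\otimes\varphi)\rho=(\rho\otimes\psi_A)\varphi$. $\lambda$-infBH-Hopf bimodule $(M,\triangleright,\triangleleft,\rho,\varphi,\alpha_M,\beta_M,\psi_M,\omega_M)$: any two of the linear maps $\alpha_M,\beta_M,\psi_M,\omega_M$ commute; it is a bimodule (with $\triangleright,\triangleleft,\alpha_M,\beta_M$) and a bicomodule (with $\rho,\varphi,\psi_M,\omega_M$); and $\rho(a\triangleright m)=\omega_A(a)m_{-1}\otimes\beta_M(m_0)+\alpha_A(a_1)\otimes a_2\triangleright\psi_M(m)+\lambda\,\alpha_A\omega_A(a)\otimes\beta_M\psi_M(m)$, $\varphi(m\triangleleft a)=\omega_M(m)\triangleleft a_1\otimes\beta_A(a_2)+\alpha_M(m_{(0)})\otimes m_{(1)}\psi_A(a)+\lambda\,\alpha_M\omega_M(m)\otimes\beta_A\psi_A(a)$,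 $\varphi(a\triangleright m)=\omega_A(a)\triangleright m_{(0)}\otimes\beta_A(m_{(1)})$, $\rho(m\triangleleft a)=\alpha_A(m_{-1})\otimes m_0\triangleleft\psi_A(a)$. (Left) BiHom-pre-Lie algebra $(A,\circ,\alpha,\beta)$: bilinear $\circ$, commuting linear multiplicative $\alpha,\beta$, with $\alpha\beta(a)\circ(\alpha(b)\circ c)-(\beta(a)\circ\alpha(b))\circ\beta(c)=\alpha\beta(b)\circ(\alpha(a)\circ c)-(\beta(b)\circ\alpha(a))\circ\beta(c)$. BiHom-pre-Lie bimodule $(M,\circ,\alpha_M,\beta_M)$ over $(A,\circ,\alpha_A,\beta_A)$: bilinear operations $a\circ m$, $m\circ a\in M$, commuting linear $\alpha_M,\beta_M$ with $f_M(a\circ m)=f_A(a)\circ f_M(m)$, $f_M(m\circ a)=f_M(m)\circ f_A(a)$ for $f\in\{\alpha,\beta\}$, and $\alpha_A\beta_A(a)\circ(\alpha_A(b)\circ m)-(\beta_A(a)\circ\alpha_A(b))\circ\beta_M(m)=\alpha_A\beta_A(b)\circ(\alpha_A(a)\circ m)-(\beta_A(b)\circ\alpha_A(a))\circ\beta_M(m)$, $\alpha_A\beta_A(a)\circ(\alpha_M(m)\circ c)-(\beta_A(a)\circ\alpha_M(m))\circ\beta_A(c)=\alpha_M\beta_M(m)\circ(\alpha_A(a)\circ c)-(\beta_M(m)\circ\alpha_A(a))\circ\beta_A(c)$.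
   Formalization: The formal theorem additionally assumes that α_M, β_M are compatible with ρ and φ (with α_A, β_A on A), and that ψ_M, ω_M are compatible with both actions (with ψ_A, ω_A on A); without this the claim fails, e.g. α_M need not respect a⋆m. *)

theory Defs
  imports Complex_Main "HOL-Library.Poly_Mapping"
begin

section \<open>Quotients of free vector spaces\<close>

text \<open>
  The ground field is a type \<open>'k::field\<close>, and a vector space over it is a type with a scalar
  multiplication satisfying the locale \<^locale>\<open>vector_space\<close>.  The tensor product depends on these
  scalar multiplications, so it cannot be a type constructor.  It is the usual quotient of the free
  vector space \<open>'x \<Rightarrow>\<^sub>0 'k\<close> on the tuples by the subspace \<open>N\<close> spanned by the multilinearity relations,
  and its elements are the cosets of \<open>N\<close>.  The operations on cosets below are defined through a
  chosen representative; for a subspace \<open>N\<close> they do not depend on the choice.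
\<close>

definition fscale :: "'k::field \<Rightarrow> ('x \<Rightarrow>\<^sub>0 'k) \<Rightarrow> 'x \<Rightarrow>\<^sub>0 'k" where
  "fscale c = Poly_Mapping.map ((*) c)"

definition fext :: "('k::field \<Rightarrow> 'v::ab_group_add \<Rightarrow> 'v) \<Rightarrow> ('x \<Rightarrow> 'v) \<Rightarrow> ('x \<Rightarrow>\<^sub>0 'k) \<Rightarrow> 'v" where
  "fext s h f = (\<Sum>x\<in>Poly_Mapping.keys f. s (Poly_Mapping.lookup f x) (h x))"

type_synonym ('k, 'x) coset = "('x \<Rightarrow>\<^sub>0 'k) set"

definition cls :: "('x \<Rightarrow>\<^sub>0 'k::field) set \<Rightarrow> ('x \<Rightarrow>\<^sub>0 'k) \<Rightarrow> ('k, 'x) coset" where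
  "cls N f = {g. g - f \<in> N}"

definition rep :: "('k::field, 'x) coset \<Rightarrow> 'x \<Rightarrow>\<^sub>0 'k" where
  "rep X = (SOME f. f \<in> X)"

definition qadd :: "('x \<Rightarrow>\<^sub>0 'k::field) set \<Rightarrow> ('k, 'x) coset \<Rightarrow> ('k, 'x) coset \<Rightarrow> ('k, 'x) coset" where
  "qadd N X Y = cls N (rep X + rep Y)"

definition qscale :: "('x \<Rightarrow>\<^sub>0 'k::field) set \<Rightarrow> 'k \<Rightarrow> ('k, 'x) coset \<Rightarrow> ('k, 'x) coset" where
  "qscale N c X = cls N (fscale c (rep X))"

definition qlinear :: "('k::field \<Rightarrow> 'v::ab_group_add \<Rightarrow> 'v) \<Rightarrow> ('x \<Rightarrow>\<^sub>0 'k) set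
    \<Rightarrow> ('v \<Rightarrow> ('k, 'x) coset) \<Rightarrow> bool" where
  "qlinear s N F \<longleftrightarrow>
     (\<forall>v. F v \<in> range (cls N)) \<and>
     (\<forall>v w. F (v + w) = qadd N (F v) (F w)) \<and>
     (\<forall>c v. F (s c v) = qscale N c (F v))"

text \<open>
  Sweedler notation.  If \<open>X\<close> is the tensor \<open>\<Sum> x\<^sub>1 \<otimes> x\<^sub>2\<close>, then \<open>slift s (\<lambda>(x, y). h x y) X\<close> is
  \<open>\<Sum> h x\<^sub>1 x\<^sub>2\<close> for a bilinear map \<open>h\<close> into a vector space with scalar multiplication \<open>s\<close>, and
  \<open>sext N (\<lambda>(x, y). h x y) X\<close> is the same sum for \<open>h\<close> with values in the cosets of \<open>N\<close>.
\<close>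

definition slift :: "('k::field \<Rightarrow> 'v::ab_group_add \<Rightarrow> 'v) \<Rightarrow> ('x \<Rightarrow> 'v) \<Rightarrow> ('k, 'x) coset \<Rightarrow> 'v" where
  "slift s h X = fext s h (rep X)"

definition sext :: "('y \<Rightarrow>\<^sub>0 'k::field) set \<Rightarrow> ('x \<Rightarrow> ('k, 'y) coset) \<Rightarrow> ('k, 'x) coset
    \<Rightarrow> ('k, 'y) coset" where
  "sext N h X = cls N (fext fscale (\<lambda>x. rep (h x)) (rep X))"


section \<open>Tensor products\<close>

abbreviation gen :: "'x \<Rightarrow> 'x \<Rightarrow>\<^sub>0 'k::field" where
  "gen x \<equiv> Poly_Mapping.single x 1"

definition null2 :: "('k::field \<Rightarrow> 'a::ab_group_add \<Rightarrow> 'a) \<Rightarrow> ('k \<Rightarrow> 'b::ab_group_add \<Rightarrow> 'b)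
    \<Rightarrow> ('a \<times> 'b \<Rightarrow>\<^sub>0 'k) set" where
  "null2 sA sB = module.span fscale
     ({gen (x + x', y) - gen (x, y) - gen (x', y) | x x' y. True} \<union>
      {gen (x, y + y') - gen (x, y) - gen (x, y') | x y y'. True} \<union>
      {gen (sA c x, y) - fscale c (gen (x, y)) | c x y. True} \<union>
      {gen (x, sB c y) - fscale c (gen (x, y)) | c x y. True})"

definition tens2 :: "('k::field \<Rightarrow> 'a::ab_group_add \<Rightarrow> 'a) \<Rightarrow> ('k \<Rightarrow> 'b::ab_group_add \<Rightarrow> 'b)
    \<Rightarrow> 'a \<Rightarrow> 'b \<Rightarrow> ('k, 'a \<times> 'b) coset" where
  "tens2 sA sB x y = cls (null2 sA sB) (gen (x, y))"

definition tmap :: "('k::field \<Rightarrow> 'c::ab_group_add \<Rightarrow> 'c) \<Rightarrow> ('k \<Rightarrow> 'd::ab_group_add \<Rightarrow> 'd)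
    \<Rightarrow> ('a \<Rightarrow> 'c) \<Rightarrow> ('b \<Rightarrow> 'd) \<Rightarrow> ('k, 'a \<times> 'b) coset \<Rightarrow> ('k, 'c \<times> 'd) coset" where
  "tmap sC sD f g = sext (null2 sC sD) (\<lambda>(x, y). tens2 sC sD (f x) (g y))"

text \<open>
  Both \<open>(A \<otimes> B) \<otimes> C\<close> and \<open>A \<otimes> (B \<otimes> C)\<close> are identified with the threefold tensor product; \<open>tmap21\<close> is
  \<open>F \<otimes> g\<close> for \<open>F\<close> with values in \<open>C \<otimes> D\<close>, and \<open>tmap12\<close> is \<open>f \<otimes> G\<close> for \<open>G\<close> with values in \<open>D \<otimes> E\<close>.
\<close>

definition null3 :: "('k::field \<Rightarrow> 'a::ab_group_add \<Rightarrow> 'a) \<Rightarrow> ('k \<Rightarrow> 'b::ab_group_add \<Rightarrow> 'b)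
    \<Rightarrow> ('k \<Rightarrow> 'c::ab_group_add \<Rightarrow> 'c) \<Rightarrow> ('a \<times> 'b \<times> 'c \<Rightarrow>\<^sub>0 'k) set" where
  "null3 sA sB sC = module.span fscale
     ({gen (x + x', y, z) - gen (x, y, z) - gen (x', y, z) | x x' y z. True} \<union>
      {gen (x, y + y', z) - gen (x, y, z) - gen (x, y', z) | x y y' z. True} \<union>
      {gen (x, y, z + z') - gen (x, y, z) - gen (x, y, z') | x y z z'. True} \<union>
      {gen (sA c x, y, z) - fscale c (gen (x, y, z)) | c x y z. True} \<union>
      {gen (x, sB c y, z) - fscale c (gen (x, y, z)) | c x y z. True} \<union>
      {gen (x, y, sC c z) - fscale c (gen (x, y, z)) | c x y z. True})"

definition tens3 :: "('k::field \<Rightarrow> 'a::ab_group_add \<Rightarrow> 'a) \<Rightarrow> ('k \<Rightarrow> 'b::ab_group_add \<Rightarrow> 'b)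
    \<Rightarrow> ('k \<Rightarrow> 'c::ab_group_add \<Rightarrow> 'c) \<Rightarrow> 'a \<Rightarrow> 'b \<Rightarrow> 'c \<Rightarrow> ('k, 'a \<times> 'b \<times> 'c) coset" where
  "tens3 sA sB sC x y z = cls (null3 sA sB sC) (gen (x, y, z))"

definition tmap21 :: "('k::field \<Rightarrow> 'c::ab_group_add \<Rightarrow> 'c) \<Rightarrow> ('k \<Rightarrow> 'd::ab_group_add \<Rightarrow> 'd)
    \<Rightarrow> ('k \<Rightarrow> 'e::ab_group_add \<Rightarrow> 'e) \<Rightarrow> ('a \<Rightarrow> ('k, 'c \<times> 'd) coset) \<Rightarrow> ('b \<Rightarrow> 'e)
    \<Rightarrow> ('k, 'a \<times> 'b) coset \<Rightarrow> ('k, 'c \<times> 'd \<times> 'e) coset" where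
  "tmap21 sC sD sE F g = sext (null3 sC sD sE)
     (\<lambda>(x, y). sext (null3 sC sD sE) (\<lambda>(u, v). tens3 sC sD sE u v (g y)) (F x))"

definition tmap12 :: "('k::field \<Rightarrow> 'c::ab_group_add \<Rightarrow> 'c) \<Rightarrow> ('k \<Rightarrow> 'd::ab_group_add \<Rightarrow> 'd)
    \<Rightarrow> ('k \<Rightarrow> 'e::ab_group_add \<Rightarrow> 'e) \<Rightarrow> ('a \<Rightarrow> 'c) \<Rightarrow> ('b \<Rightarrow> ('k, 'd \<times> 'e) coset)
    \<Rightarrow> ('k, 'a \<times> 'b) coset \<Rightarrow> ('k, 'c \<times> 'd \<times> 'e) coset" where
  "tmap12 sC sD sE f G = sext (null3 sC sD sE)
     (\<lambda>(x, y). sext (null3 sC sD sE) (\<lambda>(u, v). tens3 sC sD sE (f x) u v) (G y))"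

definition bilin :: "('k::field \<Rightarrow> 'a::ab_group_add \<Rightarrow> 'a) \<Rightarrow> ('k \<Rightarrow> 'b::ab_group_add \<Rightarrow> 'b)
    \<Rightarrow> ('k \<Rightarrow> 'c::ab_group_add \<Rightarrow> 'c) \<Rightarrow> ('a \<Rightarrow> 'b \<Rightarrow> 'c) \<Rightarrow> bool" where
  "bilin sA sB sC f \<longleftrightarrow>
     (\<forall>x. Vector_Spaces.linear sB sC (f x)) \<and> (\<forall>y. Vector_Spaces.linear sA sC (\<lambda>x. f x y))"


section \<open>BiHom-associative algebras, BiHom-coassociative coalgebras and bialgebras\<close>

locale bihom_assoc_algebra =
  fixes sA :: "'k::field \<Rightarrow> 'a::ab_group_add \<Rightarrow> 'a"
    and \<mu> :: "'a \<Rightarrow> 'a \<Rightarrow> 'a" (infixl \<open>\<bullet>\<close> 70)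
    and \<alpha> \<beta> :: "'a \<Rightarrow> 'a"
  assumes vector_space_A: "vector_space sA"
    and bilin_mult: "bilin sA sA sA (\<bullet>)"
    and linear_\<alpha>: "Vector_Spaces.linear sA sA \<alpha>"
    and linear_\<beta>: "Vector_Spaces.linear sA sA \<beta>"
    and \<alpha>_\<beta>: "\<alpha> (\<beta> a) = \<beta> (\<alpha> a)"
    and \<alpha>_mult: "\<alpha> (a \<bullet> b) = \<alpha> a \<bullet> \<alpha> b"
    and \<beta>_mult: "\<beta> (a \<bullet> b) = \<beta> a \<bullet> \<beta> b"
    and bihom_assoc: "\<alpha> a \<bullet> (b \<bullet> c) = (a \<bullet> b) \<bullet> \<beta> c"

locale bihom_coassoc_coalgebra =
  fixes sC :: "'k::field \<Rightarrow> 'c::ab_group_add \<Rightarrow> 'c"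
    and \<Delta> :: "'c \<Rightarrow> ('k, 'c \<times> 'c) coset"
    and \<psi> \<omega> :: "'c \<Rightarrow> 'c"
  assumes vector_space_C: "vector_space sC"
    and linear_\<Delta>: "qlinear sC (null2 sC sC) \<Delta>"
    and linear_\<psi>: "Vector_Spaces.linear sC sC \<psi>"
    and linear_\<omega>: "Vector_Spaces.linear sC sC \<omega>"
    and \<psi>_\<omega>: "\<psi> (\<omega> c) = \<omega> (\<psi> c)"
    and \<psi>_comult: "tmap sC sC \<psi> \<psi> (\<Delta> c) = \<Delta> (\<psi> c)"
    and \<omega>_comult: "tmap sC sC \<omega> \<omega> (\<Delta> c) = \<Delta> (\<omega> c)"
    and bihom_coassoc: "tmap21 sC sC sC \<Delta> \<psi> (\<Delta> c) = tmap12 sC sC sC \<omega> \<Delta> (\<Delta> c)"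

locale infBH_bialgebra =
  bihom_assoc_algebra sA \<mu> \<alpha> \<beta> + bihom_coassoc_coalgebra sA \<Delta> \<psi> \<omega>
  for l :: "'k::field"
    and sA :: "'k \<Rightarrow> 'a::ab_group_add \<Rightarrow> 'a"
    and \<mu> :: "'a \<Rightarrow> 'a \<Rightarrow> 'a" (infixl \<open>\<bullet>\<close> 70)
    and \<Delta> :: "'a \<Rightarrow> ('k, 'a \<times> 'a) coset"
    and \<alpha> \<beta> \<psi> \<omega> :: "'a \<Rightarrow> 'a" +
  assumes \<alpha>_\<psi>: "\<alpha> (\<psi> a) = \<psi> (\<alpha> a)"
    and \<alpha>_\<omega>: "\<alpha> (\<omega> a) = \<omega> (\<alpha> a)"
    and \<beta>_\<psi>: "\<beta> (\<psi> a) = \<psi> (\<beta> a)"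
    and \<beta>_\<omega>: "\<beta> (\<omega> a) = \<omega> (\<beta> a)"
    and \<alpha>_comult: "tmap sA sA \<alpha> \<alpha> (\<Delta> a) = \<Delta> (\<alpha> a)"
    and \<beta>_comult: "tmap sA sA \<beta> \<beta> (\<Delta> a) = \<Delta> (\<beta> a)"
    and \<psi>_mult: "\<psi> (a \<bullet> b) = \<psi> a \<bullet> \<psi> b"
    and \<omega>_mult: "\<omega> (a \<bullet> b) = \<omega> a \<bullet> \<omega> b"
    and comult_mult: "\<Delta> (a \<bullet> b) =
      qadd (null2 sA sA)
        (qadd (null2 sA sA)
          (sext (null2 sA sA) (\<lambda>(b1, b2). tens2 sA sA (\<omega> a \<bullet> b1) (\<beta> b2)) (\<Delta> b))
          (sext (null2 sA sA) (\<lambda>(a1, a2). tens2 sA sA (\<alpha> a1) (a2 \<bullet> \<psi> b)) (\<Delta> a)))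
        (qscale (null2 sA sA) l (tens2 sA sA (\<alpha> (\<omega> a)) (\<beta> (\<psi> b))))"


section \<open>Bimodules, bicomodules and Hopf bimodules\<close>

locale bihom_bimodule =
  bihom_assoc_algebra sA \<mu> \<alpha>\<^sub>A \<beta>\<^sub>A
  for sA :: "'k::field \<Rightarrow> 'a::ab_group_add \<Rightarrow> 'a"
    and \<mu> :: "'a \<Rightarrow> 'a \<Rightarrow> 'a" (infixl \<open>\<bullet>\<close> 70)
    and \<alpha>\<^sub>A \<beta>\<^sub>A :: "'a \<Rightarrow> 'a" +
  fixes sM :: "'k \<Rightarrow> 'm::ab_group_add \<Rightarrow> 'm"
    and actl :: "'a \<Rightarrow> 'm \<Rightarrow> 'm" (infixr \<open>\<rhd>\<close> 70)
    and actr :: "'m \<Rightarrow> 'a \<Rightarrow> 'm" (infixl \<open>\<lhd>\<close> 70)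
    and \<alpha>\<^sub>M \<beta>\<^sub>M :: "'m \<Rightarrow> 'm"
  assumes vector_space_M: "vector_space sM"
    and bilin_actl: "bilin sA sM sM (\<rhd>)"
    and bilin_actr: "bilin sM sA sM (\<lhd>)"
    and linear_\<alpha>\<^sub>M: "Vector_Spaces.linear sM sM \<alpha>\<^sub>M"
    and linear_\<beta>\<^sub>M: "Vector_Spaces.linear sM sM \<beta>\<^sub>M"
    and \<alpha>\<^sub>M_\<beta>\<^sub>M: "\<alpha>\<^sub>M (\<beta>\<^sub>M m) = \<beta>\<^sub>M (\<alpha>\<^sub>M m)"
    and \<alpha>\<^sub>M_actl: "\<alpha>\<^sub>M (a \<rhd> m) = \<alpha>\<^sub>A a \<rhd> \<alpha>\<^sub>M m"
    and \<beta>\<^sub>M_actl: "\<beta>\<^sub>M (a \<rhd> m) = \<beta>\<^sub>A a \<rhd> \<beta>\<^sub>M m"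
    and \<alpha>\<^sub>M_actr: "\<alpha>\<^sub>M (m \<lhd> a) = \<alpha>\<^sub>M m \<lhd> \<alpha>\<^sub>A a"
    and \<beta>\<^sub>M_actr: "\<beta>\<^sub>M (m \<lhd> a) = \<beta>\<^sub>M m \<lhd> \<beta>\<^sub>A a"
    and actl_actl: "\<alpha>\<^sub>A a \<rhd> (a' \<rhd> m) = (a \<bullet> a') \<rhd> \<beta>\<^sub>M m"
    and actr_actr: "\<alpha>\<^sub>M m \<lhd> (a \<bullet> a') = (m \<lhd> a) \<lhd> \<beta>\<^sub>A a'"
    and actl_actr: "\<alpha>\<^sub>A a \<rhd> (m \<lhd> a') = (a \<rhd> m) \<lhd> \<beta>\<^sub>A a'"

locale bihom_bicomodule =
  bihom_coassoc_coalgebra sA \<Delta> \<psi>\<^sub>A \<omega>\<^sub>A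
  for sA :: "'k::field \<Rightarrow> 'a::ab_group_add \<Rightarrow> 'a"
    and \<Delta> :: "'a \<Rightarrow> ('k, 'a \<times> 'a) coset"
    and \<psi>\<^sub>A \<omega>\<^sub>A :: "'a \<Rightarrow> 'a" +
  fixes sM :: "'k \<Rightarrow> 'm::ab_group_add \<Rightarrow> 'm"
    and \<rho> :: "'m \<Rightarrow> ('k, 'a \<times> 'm) coset"
    and \<phi> :: "'m \<Rightarrow> ('k, 'm \<times> 'a) coset"
    and \<psi>\<^sub>M \<omega>\<^sub>M :: "'m \<Rightarrow> 'm"
  assumes vector_space_M: "vector_space sM"
    and linear_\<rho>: "qlinear sM (null2 sA sM) \<rho>"
    and linear_\<phi>: "qlinear sM (null2 sM sA) \<phi>"
    and linear_\<psi>\<^sub>M: "Vector_Spaces.linear sM sM \<psi>\<^sub>M"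
    and linear_\<omega>\<^sub>M: "Vector_Spaces.linear sM sM \<omega>\<^sub>M"
    and \<psi>\<^sub>M_\<omega>\<^sub>M: "\<psi>\<^sub>M (\<omega>\<^sub>M m) = \<omega>\<^sub>M (\<psi>\<^sub>M m)"
    and \<psi>\<^sub>M_\<rho>: "tmap sA sM \<psi>\<^sub>A \<psi>\<^sub>M (\<rho> m) = \<rho> (\<psi>\<^sub>M m)"
    and \<omega>\<^sub>M_\<rho>: "tmap sA sM \<omega>\<^sub>A \<omega>\<^sub>M (\<rho> m) = \<rho> (\<omega>\<^sub>M m)"
    and \<psi>\<^sub>M_\<phi>: "tmap sM sA \<psi>\<^sub>M \<psi>\<^sub>A (\<phi> m) = \<phi> (\<psi>\<^sub>M m)"
    and \<omega>\<^sub>M_\<phi>: "tmap sM sA \<omega>\<^sub>M \<omega>\<^sub>A (\<phi> m) = \<phi> (\<omega>\<^sub>M m)"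
    and \<rho>_\<rho>: "tmap12 sA sA sM \<omega>\<^sub>A \<rho> (\<rho> m) = tmap21 sA sA sM \<Delta> \<psi>\<^sub>M (\<rho> m)"
    and \<phi>_\<phi>: "tmap12 sM sA sA \<omega>\<^sub>M \<Delta> (\<phi> m) = tmap21 sM sA sA \<phi> \<psi>\<^sub>A (\<phi> m)"
    and \<rho>_\<phi>: "tmap12 sA sM sA \<omega>\<^sub>A \<phi> (\<rho> m) = tmap21 sA sM sA \<rho> \<psi>\<^sub>A (\<phi> m)"

locale infBH_hopf_bimodule =
  infBH_bialgebra l sA \<mu> \<Delta> \<alpha>\<^sub>A \<beta>\<^sub>A \<psi>\<^sub>A \<omega>\<^sub>A +
  bihom_bimodule sA \<mu> \<alpha>\<^sub>A \<beta>\<^sub>A sM actl actr \<alpha>\<^sub>M \<beta>\<^sub>M +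
  bihom_bicomodule sA \<Delta> \<psi>\<^sub>A \<omega>\<^sub>A sM \<rho> \<phi> \<psi>\<^sub>M \<omega>\<^sub>M
  for l :: "'k::field"
    and sA :: "'k \<Rightarrow> 'a::ab_group_add \<Rightarrow> 'a"
    and \<mu> :: "'a \<Rightarrow> 'a \<Rightarrow> 'a" (infixl \<open>\<bullet>\<close> 70)
    and \<Delta> :: "'a \<Rightarrow> ('k, 'a \<times> 'a) coset"
    and \<alpha>\<^sub>A \<beta>\<^sub>A \<psi>\<^sub>A \<omega>\<^sub>A :: "'a \<Rightarrow> 'a"
    and sM :: "'k \<Rightarrow> 'm::ab_group_add \<Rightarrow> 'm"
    and actl :: "'a \<Rightarrow> 'm \<Rightarrow> 'm" (infixr \<open>\<rhd>\<close> 70)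
    and actr :: "'m \<Rightarrow> 'a \<Rightarrow> 'm" (infixl \<open>\<lhd>\<close> 70)
    and \<rho> :: "'m \<Rightarrow> ('k, 'a \<times> 'm) coset"
    and \<phi> :: "'m \<Rightarrow> ('k, 'm \<times> 'a) coset"
    and \<alpha>\<^sub>M \<beta>\<^sub>M \<psi>\<^sub>M \<omega>\<^sub>M :: "'m \<Rightarrow> 'm" +
  assumes \<alpha>\<^sub>M_\<psi>\<^sub>M: "\<alpha>\<^sub>M (\<psi>\<^sub>M m) = \<psi>\<^sub>M (\<alpha>\<^sub>M m)"
    and \<alpha>\<^sub>M_\<omega>\<^sub>M: "\<alpha>\<^sub>M (\<omega>\<^sub>M m) = \<omega>\<^sub>M (\<alpha>\<^sub>M m)"
    and \<beta>\<^sub>M_\<psi>\<^sub>M: "\<beta>\<^sub>M (\<psi>\<^sub>M m) = \<psi>\<^sub>M (\<beta>\<^sub>M m)"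
    and \<beta>\<^sub>M_\<omega>\<^sub>M: "\<beta>\<^sub>M (\<omega>\<^sub>M m) = \<omega>\<^sub>M (\<beta>\<^sub>M m)"
    and \<rho>_actl: "\<rho> (a \<rhd> m) =
      qadd (null2 sA sM)
        (qadd (null2 sA sM)
          (sext (null2 sA sM) (\<lambda>(m1, m0). tens2 sA sM (\<omega>\<^sub>A a \<bullet> m1) (\<beta>\<^sub>M m0)) (\<rho> m))
          (sext (null2 sA sM) (\<lambda>(a1, a2). tens2 sA sM (\<alpha>\<^sub>A a1) (a2 \<rhd> \<psi>\<^sub>M m)) (\<Delta> a)))
        (qscale (null2 sA sM) l (tens2 sA sM (\<alpha>\<^sub>A (\<omega>\<^sub>A a)) (\<beta>\<^sub>M (\<psi>\<^sub>M m))))"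
    and \<phi>_actr: "\<phi> (m \<lhd> a) =
      qadd (null2 sM sA)
        (qadd (null2 sM sA)
          (sext (null2 sM sA) (\<lambda>(a1, a2). tens2 sM sA (\<omega>\<^sub>M m \<lhd> a1) (\<beta>\<^sub>A a2)) (\<Delta> a))
          (sext (null2 sM sA) (\<lambda>(m0, m1). tens2 sM sA (\<alpha>\<^sub>M m0) (m1 \<bullet> \<psi>\<^sub>A a)) (\<phi> m)))
        (qscale (null2 sM sA) l (tens2 sM sA (\<alpha>\<^sub>M (\<omega>\<^sub>M m)) (\<beta>\<^sub>A (\<psi>\<^sub>A a))))"
    and \<phi>_actl: "\<phi> (a \<rhd> m) =
      sext (null2 sM sA) (\<lambda>(m0, m1). tens2 sM sA (\<omega>\<^sub>A a \<rhd> m0) (\<beta>\<^sub>A m1)) (\<phi> m)"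
    and \<rho>_actr: "\<rho> (m \<lhd> a) =
      sext (null2 sA sM) (\<lambda>(m1, m0). tens2 sA sM (\<alpha>\<^sub>A m1) (m0 \<lhd> \<psi>\<^sub>A a)) (\<rho> m)"

text \<open>
  The analogue for \<open>M\<close> of the bialgebra axioms that \<open>\<alpha>\<close>, \<open>\<beta>\<close> are comultiplicative and \<open>\<psi>\<close>, \<open>\<omega>\<close> are
  multiplicative.  It does not follow from \<^locale>\<open>infBH_hopf_bimodule\<close>, and without it the operations
  \<open>\<star>\<close> need not even be compatible with \<open>\<alpha>\<^sub>M\<close>.  Take \<open>\<lambda> = 0\<close>, \<open>A = K\<close> with its multiplication and
  \<open>\<Delta> = 0\<close>, \<open>M = K e\<^sub>0 \<oplus> K e\<^sub>1\<close> with scalar multiplication as \<open>\<rhd>\<close>, \<open>\<lhd> = 0\<close>, \<open>\<phi> = 0\<close>, \<open>\<rho>(e\<^sub>0) = 0\<close>,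
  \<open>\<rho>(e\<^sub>1) = 1 \<otimes> e\<^sub>0\<close>, \<open>\<alpha>\<^sub>M(e\<^sub>0) = c e\<^sub>0\<close>, \<open>\<alpha>\<^sub>M(e\<^sub>1) = e\<^sub>1\<close> with \<open>c \<notin> {0, 1}\<close>, and all other structure maps the
  identity.  This is a Hopf bimodule with invertible structure maps, but \<open>1 \<star> e\<^sub>1 = e\<^sub>0\<close>, so that
  \<open>\<alpha>\<^sub>M(1 \<star> e\<^sub>1) = c e\<^sub>0\<close> while \<open>\<alpha>\<^sub>A(1) \<star> \<alpha>\<^sub>M(e\<^sub>1) = e\<^sub>0\<close>.
\<close>

definition hopf_bimodule_maps_compatible ::
    "('k::field \<Rightarrow> 'a::ab_group_add \<Rightarrow> 'a) \<Rightarrow> ('a \<Rightarrow> 'a) \<Rightarrow> ('a \<Rightarrow> 'a) \<Rightarrow> ('a \<Rightarrow> 'a) \<Rightarrow> ('a \<Rightarrow> 'a)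
     \<Rightarrow> ('k \<Rightarrow> 'm::ab_group_add \<Rightarrow> 'm) \<Rightarrow> ('a \<Rightarrow> 'm \<Rightarrow> 'm) \<Rightarrow> ('m \<Rightarrow> 'a \<Rightarrow> 'm)
     \<Rightarrow> ('m \<Rightarrow> ('k, 'a \<times> 'm) coset) \<Rightarrow> ('m \<Rightarrow> ('k, 'm \<times> 'a) coset)
     \<Rightarrow> ('m \<Rightarrow> 'm) \<Rightarrow> ('m \<Rightarrow> 'm) \<Rightarrow> ('m \<Rightarrow> 'm) \<Rightarrow> ('m \<Rightarrow> 'm) \<Rightarrow> bool" where
  "hopf_bimodule_maps_compatible sA \<alpha>\<^sub>A \<beta>\<^sub>A \<psi>\<^sub>A \<omega>\<^sub>A sM actl actr \<rho> \<phi> \<alpha>\<^sub>M \<beta>\<^sub>M \<psi>\<^sub>M \<omega>\<^sub>M \<longleftrightarrow>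
     (\<forall>m. tmap sA sM \<alpha>\<^sub>A \<alpha>\<^sub>M (\<rho> m) = \<rho> (\<alpha>\<^sub>M m)) \<and>
     (\<forall>m. tmap sA sM \<beta>\<^sub>A \<beta>\<^sub>M (\<rho> m) = \<rho> (\<beta>\<^sub>M m)) \<and>
     (\<forall>m. tmap sM sA \<alpha>\<^sub>M \<alpha>\<^sub>A (\<phi> m) = \<phi> (\<alpha>\<^sub>M m)) \<and>
     (\<forall>m. tmap sM sA \<beta>\<^sub>M \<beta>\<^sub>A (\<phi> m) = \<phi> (\<beta>\<^sub>M m)) \<and>
     (\<forall>a m. \<psi>\<^sub>M (actl a m) = actl (\<psi>\<^sub>A a) (\<psi>\<^sub>M m)) \<and>
     (\<forall>a m. \<omega>\<^sub>M (actl a m) = actl (\<omega>\<^sub>A a) (\<omega>\<^sub>M m)) \<and>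
     (\<forall>a m. \<psi>\<^sub>M (actr m a) = actr (\<psi>\<^sub>M m) (\<psi>\<^sub>A a)) \<and>
     (\<forall>a m. \<omega>\<^sub>M (actr m a) = actr (\<omega>\<^sub>M m) (\<omega>\<^sub>A a))"


section \<open>BiHom-pre-Lie algebras and bimodules\<close>

locale bihom_pre_lie_algebra =
  fixes sA :: "'k::field \<Rightarrow> 'a::ab_group_add \<Rightarrow> 'a"
    and circ :: "'a \<Rightarrow> 'a \<Rightarrow> 'a" (infixl \<open>\<odot>\<close> 70)
    and \<alpha> \<beta> :: "'a \<Rightarrow> 'a"
  assumes vector_space_A: "vector_space sA"
    and bilin_circ: "bilin sA sA sA (\<odot>)"
    and linear_\<alpha>: "Vector_Spaces.linear sA sA \<alpha>"
    and linear_\<beta>: "Vector_Spaces.linear sA sA \<beta>"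
    and \<alpha>_\<beta>: "\<alpha> (\<beta> a) = \<beta> (\<alpha> a)"
    and \<alpha>_circ: "\<alpha> (a \<odot> b) = \<alpha> a \<odot> \<alpha> b"
    and \<beta>_circ: "\<beta> (a \<odot> b) = \<beta> a \<odot> \<beta> b"
    and pre_lie: "\<alpha> (\<beta> a) \<odot> (\<alpha> b \<odot> c) - (\<beta> a \<odot> \<alpha> b) \<odot> \<beta> c
                = \<alpha> (\<beta> b) \<odot> (\<alpha> a \<odot> c) - (\<beta> b \<odot> \<alpha> a) \<odot> \<beta> c"

locale bihom_pre_lie_bimodule =
  bihom_pre_lie_algebra sA circ \<alpha>\<^sub>A \<beta>\<^sub>A
  for sA :: "'k::field \<Rightarrow> 'a::ab_group_add \<Rightarrow> 'a"
    and circ :: "'a \<Rightarrow> 'a \<Rightarrow> 'a" (infixl \<open>\<odot>\<close> 70)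
    and \<alpha>\<^sub>A \<beta>\<^sub>A :: "'a \<Rightarrow> 'a" +
  fixes sM :: "'k \<Rightarrow> 'm::ab_group_add \<Rightarrow> 'm"
    and circl :: "'a \<Rightarrow> 'm \<Rightarrow> 'm" (infixl \<open>\<odot>\<^sub>l\<close> 70)
    and circr :: "'m \<Rightarrow> 'a \<Rightarrow> 'm" (infixl \<open>\<odot>\<^sub>r\<close> 70)
    and \<alpha>\<^sub>M \<beta>\<^sub>M :: "'m \<Rightarrow> 'm"
  assumes vector_space_M: "vector_space sM"
    and bilin_circl: "bilin sA sM sM (\<odot>\<^sub>l)"
    and bilin_circr: "bilin sM sA sM (\<odot>\<^sub>r)"
    and linear_\<alpha>\<^sub>M: "Vector_Spaces.linear sM sM \<alpha>\<^sub>M"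
    and linear_\<beta>\<^sub>M: "Vector_Spaces.linear sM sM \<beta>\<^sub>M"
    and \<alpha>\<^sub>M_\<beta>\<^sub>M: "\<alpha>\<^sub>M (\<beta>\<^sub>M m) = \<beta>\<^sub>M (\<alpha>\<^sub>M m)"
    and \<alpha>\<^sub>M_circl: "\<alpha>\<^sub>M (a \<odot>\<^sub>l m) = \<alpha>\<^sub>A a \<odot>\<^sub>l \<alpha>\<^sub>M m"
    and \<beta>\<^sub>M_circl: "\<beta>\<^sub>M (a \<odot>\<^sub>l m) = \<beta>\<^sub>A a \<odot>\<^sub>l \<beta>\<^sub>M m"
    and \<alpha>\<^sub>M_circr: "\<alpha>\<^sub>M (m \<odot>\<^sub>r a) = \<alpha>\<^sub>M m \<odot>\<^sub>r \<alpha>\<^sub>A a"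
    and \<beta>\<^sub>M_circr: "\<beta>\<^sub>M (m \<odot>\<^sub>r a) = \<beta>\<^sub>M m \<odot>\<^sub>r \<beta>\<^sub>A a"
    and pre_lie_left:
      "\<alpha>\<^sub>A (\<beta>\<^sub>A a) \<odot>\<^sub>l (\<alpha>\<^sub>A b \<odot>\<^sub>l m) - (\<beta>\<^sub>A a \<odot> \<alpha>\<^sub>A b) \<odot>\<^sub>l \<beta>\<^sub>M m
       = \<alpha>\<^sub>A (\<beta>\<^sub>A b) \<odot>\<^sub>l (\<alpha>\<^sub>A a \<odot>\<^sub>l m) - (\<beta>\<^sub>A b \<odot> \<alpha>\<^sub>A a) \<odot>\<^sub>l \<beta>\<^sub>M m"
    and pre_lie_right:
      "\<alpha>\<^sub>A (\<beta>\<^sub>A a) \<odot>\<^sub>l (\<alpha>\<^sub>M m \<odot>\<^sub>r c) - (\<beta>\<^sub>A a \<odot>\<^sub>l \<alpha>\<^sub>M m) \<odot>\<^sub>r \<beta>\<^sub>A c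
       = \<alpha>\<^sub>M (\<beta>\<^sub>M m) \<odot>\<^sub>r (\<alpha>\<^sub>A a \<odot> c) - (\<beta>\<^sub>M m \<odot>\<^sub>r \<alpha>\<^sub>A a) \<odot>\<^sub>r \<beta>\<^sub>A c"

end

theory Submission
  imports Defs
begin

text \<open>
  As the structure maps are invertible, the BiHom structure can be untwisted: the multiplication
  \<open>a \<cdot> b = \<alpha>\<^sup>-\<^sup>1(a) \<beta>\<^sup>-\<^sup>1(b)\<close> (with the analogous actions on \<open>M\<close>) is associative, the comultiplication
  \<open>(\<omega>\<^sup>-\<^sup>1 \<otimes> \<psi>\<^sup>-\<^sup>1) \<Delta>\<close> (with the analogous coactions) is coassociative, and both satisfy the \<open>\<lambda>\<close>-infinitesimal
  compatibility without structure maps.  In terms of \<open>a \<circ> b = b\<^sub>1 a b\<^sub>2\<close>, formed with these operations,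
  \<open>a \<star> b = \<alpha>(a) \<circ> \<beta>(b)\<close>, so the BiHom identities for \<open>\<star>\<close> reduce to the ordinary pre-Lie identities for
  \<open>\<circ>\<close>.  Compatibility gives \<open>a \<circ> (b c) = b (a \<circ> c) + (a \<circ> b) c + \<lambda> b a c\<close>, hence
  \<open>a \<circ> (b \<circ> c) - (a \<circ> b) \<circ> c = c\<^sub>1 b (a \<circ> c\<^sub>2) + (a \<circ> c\<^sub>1) b c\<^sub>2 + \<lambda> (c\<^sub>1 a b c\<^sub>2 + c\<^sub>1 b a c\<^sub>2)\<close>.
  By coassociativity \<open>c\<^sub>1 b (a \<circ> c\<^sub>2) = (b \<circ> c\<^sub>1) a c\<^sub>2\<close>, so this is symmetric in \<open>a\<close> and \<open>b\<close>.  The two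
  bimodule identities follow in the same way with one of the arguments in \<open>M\<close>.
\<close>

section \<open>Linear extension and Sweedler sums\<close>

lemma lookup_fscale: "Poly_Mapping.lookup (fscale c f) x = c * Poly_Mapping.lookup f x"
  by (simp add: fscale_def map.rep_eq when_def)

lemma vector_space_fscale: "vector_space (fscale :: 'k::field \<Rightarrow> ('x \<Rightarrow>\<^sub>0 'k) \<Rightarrow> 'x \<Rightarrow>\<^sub>0 'k)"
  by unfold_locales (auto intro!: poly_mapping_eqI simp: lookup_fscale lookup_add algebra_simps)

lemma linearI:
  assumes "vector_space s" "vector_space t" "\<And>x y. f (x + y) = f x + f y" "\<And>c x. f (s c x) = t c (f x)"
  shows "Vector_Spaces.linear s t f"
  using assms by (simp add: Vector_Spaces.linear_iff)

lemma linear_addD: "Vector_Spaces.linear s t f \<Longrightarrow> f (x + y) = f x + f y"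
  and linear_scaleD: "Vector_Spaces.linear s t f \<Longrightarrow> f (s c x) = t c (f x)"
  and linear_vector_space1: "Vector_Spaces.linear s t f \<Longrightarrow> vector_space s"
  and linear_vector_space2: "Vector_Spaces.linear s t f \<Longrightarrow> vector_space t"
  by (simp_all add: Vector_Spaces.linear_iff)

lemma linear_diffD: "Vector_Spaces.linear s t f \<Longrightarrow> f (x - y) = f x - f y"
  by (metis add_diff_cancel_right' diff_add_cancel linear_addD)

lemma linear_sumD: "Vector_Spaces.linear s t f \<Longrightarrow> f (sum g X) = (\<Sum>x\<in>X. f (g x))"
  by (simp add: linear_iff_module_hom module_hom.sum)

text \<open>Indices outside the support contribute zero, so the linear extensions of two elements
  can be compared over a common finite index set.\<close>

lemma fext_superset:
  assumes "vector_space s" "finite S" "Poly_Mapping.keys f \<subseteq> S"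
  shows "fext s h f = (\<Sum>x\<in>S. s (Poly_Mapping.lookup f x) (h x))"
proof -
  interpret vector_space s by fact
  show ?thesis
    unfolding fext_def using assms(2,3) by (intro sum.mono_neutral_left) (auto simp: in_keys_iff)
qed

lemma linear_fext:
  assumes "vector_space s"
  shows "Vector_Spaces.linear fscale s (fext s h)"
proof -
  interpret vector_space s by fact
  show ?thesis
  proof (rule linearI[OF vector_space_fscale assms])
    fix f g :: "'c \<Rightarrow>\<^sub>0 'a" and c :: 'a
    let ?S = "Poly_Mapping.keys f \<union> Poly_Mapping.keys g"
    have "fext s h (f + g) = (\<Sum>x\<in>?S. s (Poly_Mapping.lookup (f + g) x) (h x))"
      by (rule fext_superset[OF assms]) (use keys_add[of f g] in auto)
    also have "\<dots> = (\<Sum>x\<in>?S. s (Poly_Mapping.lookup f x) (h x)) + (\<Sum>x\<in>?S. s (Poly_Mapping.lookup g x) (h x))"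
      by (simp add: lookup_add scale_left_distrib sum.distrib)
    also have "\<dots> = fext s h f + fext s h g"
      by (simp add: fext_superset[OF assms, of ?S])
    finally show "fext s h (f + g) = fext s h f + fext s h g" .
    have "fext s h (fscale c f) = (\<Sum>x\<in>Poly_Mapping.keys f. s (Poly_Mapping.lookup (fscale c f) x) (h x))"
      by (rule fext_superset[OF assms]) (auto simp: in_keys_iff lookup_fscale)
    then show "fext s h (fscale c f) = s c (fext s h f)"
      by (simp add: lookup_fscale fext_def scale_sum_right)
  qed
qed

lemma fext_gen: "vector_space s \<Longrightarrow> fext s h (gen x) = h x"
  by (simp add: fext_def vector_space.vector_space_assms(4))

lemma linear_fext_comp:
  assumes "Vector_Spaces.linear s t L"
  shows "L (fext s h f) = fext t (\<lambda>x. L (h x)) f"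
  by (simp add: fext_def linear_sumD[OF assms] linear_scaleD[OF assms])

text \<open>This is the condition under which evaluation on a coset of \<open>N\<close> does not
  depend on the representative picked by \<open>rep\<close>: the linear extension of
  \<open>h\<close> kills \<open>N\<close>.\<close>

definition annihilates :: "('k::field \<Rightarrow> 'v::ab_group_add \<Rightarrow> 'v) \<Rightarrow> ('x \<Rightarrow>\<^sub>0 'k) set \<Rightarrow> ('x \<Rightarrow> 'v) \<Rightarrow> bool" where
  "annihilates s N h \<longleftrightarrow> vector_space s \<and> module.subspace fscale N \<and> (\<forall>f\<in>N. fext s h f = 0)"

lemma annihilates_span:
  assumes "vector_space s" "\<And>f. f \<in> G \<Longrightarrow> fext s h f = 0"
  shows "annihilates s (module.span fscale G) h"
proof -
  interpret F: vector_space "fscale :: 'a \<Rightarrow> ('c \<Rightarrow>\<^sub>0 'a) \<Rightarrow> _" by (rule vector_space_fscale)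
  interpret vector_space s by fact
  note lin = linear_fext[OF assms(1), of h]
  have "fext s h f = 0" if "f \<in> F.span G" for f
    using that
    by (induction rule: F.span_induct_alt)
      (simp_all add: fext_def[of _ _ 0] linear_addD[OF lin] linear_scaleD[OF lin] assms(2))
  then show ?thesis
    by (simp add: annihilates_def assms(1))
qed

text \<open>Since 0 lies in \<open>N\<close>, the coset of \<open>f\<close> contains
  \<open>f\<close> and the choice in \<open>rep\<close> is meaningful; the representative differs
  from \<open>f\<close> by an element of \<open>N\<close>, which the extension of \<open>h\<close>
  kills.\<close>

lemma fext_rep_cls:
  assumes "annihilates s N h"
  shows "fext s h (rep (cls N f)) = fext s h f"
proof -
  interpret F: vector_space "fscale :: 'a \<Rightarrow> ('c \<Rightarrow>\<^sub>0 'a) \<Rightarrow> _" by (rule vector_space_fscale)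
  have "f \<in> cls N f"
    using assms by (simp add: annihilates_def cls_def F.subspace_0)
  then have "rep (cls N f) \<in> cls N f"
    unfolding rep_def by (rule someI)
  then have "fext s h (rep (cls N f) - f) = 0"
    using assms by (simp add: annihilates_def cls_def)
  moreover have "Vector_Spaces.linear fscale s (fext s h)"
    using assms by (simp add: annihilates_def linear_fext)
  ultimately show ?thesis
    by (simp add: linear_diffD)
qed

lemma slift_cls: "annihilates s N h \<Longrightarrow> slift s h (cls N f) = fext s h f"
  by (simp add: slift_def fext_rep_cls)

lemma slift_qadd:
  assumes "annihilates s N h"
  shows "slift s h (qadd N X Y) = slift s h X + slift s h Y"
proof -
  have "Vector_Spaces.linear fscale s (fext s h)"
    using assms by (simp add: annihilates_def linear_fext)
  then show ?thesis
    by (simp add: qadd_def slift_def fext_rep_cls[OF assms] linear_addD)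
qed

lemma slift_qscale:
  assumes "annihilates s N h"
  shows "slift s h (qscale N c X) = s c (slift s h X)"
proof -
  have "Vector_Spaces.linear fscale s (fext s h)"
    using assms by (simp add: annihilates_def linear_fext)
  then show ?thesis
    by (simp add: qscale_def slift_def fext_rep_cls[OF assms] linear_scaleD)
qed

text \<open>Both sides run over the same representative of \<open>X\<close>, so well-definedness is
  at issue only for the cosets of \<open>N\<close>, where \<open>h\<close> killing \<open>N\<close>
  settles it.\<close>

lemma slift_sext:
  assumes "annihilates s N h"
  shows "slift s h (sext N g X) = slift s (\<lambda>x. slift s h (g x)) X"
proof -
  have "Vector_Spaces.linear fscale s (fext s h)"
    using assms by (simp add: annihilates_def linear_fext)
  then show ?thesis
    unfolding sext_def slift_cls[OF assms] by (simp add: slift_def linear_fext_comp)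
qed

lemma slift_linear_comp:
  "Vector_Spaces.linear s t L \<Longrightarrow> L (slift s h X) = slift t (\<lambda>x. L (h x)) X"
  by (simp add: slift_def linear_fext_comp)

lemma slift_add:
  assumes "vector_space s"
  shows "slift s (\<lambda>x. g x + h x) X = slift s g X + slift s h X"
proof -
  interpret vector_space s by fact
  show ?thesis by (simp add: slift_def fext_def scale_right_distrib sum.distrib)
qed

lemma linear_slift_integrand:
  assumes "vector_space r" "vector_space s" "\<And>x. Vector_Spaces.linear r s (\<lambda>v. h v x)"
  shows "Vector_Spaces.linear r s (\<lambda>v. slift s (h v) X)"
proof -
  interpret vector_space s by fact
  show ?thesis
    by (rule linearI[OF assms(1,2)])
      (simp_all add: slift_def fext_def linear_addD[OF assms(3)] linear_scaleD[OF assms(3)]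
        scale_right_distrib sum.distrib scale_sum_right mult.commute)
qed

lemma linear_slift_qlinear:
  assumes "vector_space r" "qlinear r N F" "annihilates s N h"
  shows "Vector_Spaces.linear r s (\<lambda>v. slift s h (F v))"
  using assms by (intro linearI) (auto simp: qlinear_def slift_qadd slift_qscale annihilates_def)

section \<open>Bilinear and trilinear maps out of tensor products\<close>

lemma bilinI:
  assumes "\<And>x. Vector_Spaces.linear sB sC (f x)" "\<And>y. Vector_Spaces.linear sA sC (\<lambda>x. f x y)"
  shows "bilin sA sB sC f"
  using assms by (simp add: bilin_def)

lemma bilin_right: "bilin sA sB sC f \<Longrightarrow> Vector_Spaces.linear sB sC (f x)"
  and bilin_left: "bilin sA sB sC f \<Longrightarrow> Vector_Spaces.linear sA sC (\<lambda>x. f x y)"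
  by (simp_all add: bilin_def)

text \<open>The generators of \<open>null2\<close> are the bilinearity defects, and vanishing on
  generators passes to the span. This is the universal property of the tensor product in the form
  used below.\<close>

lemma bilin_annihilates:
  assumes "bilin sA sB s h"
  shows "annihilates s (null2 sA sB) (\<lambda>(x, y). h x y)"
proof -
  note lin = bilin_right[OF assms] bilin_left[OF assms]
  have vs: "vector_space s" using lin(1) by (rule linear_vector_space2)
  note F = linear_fext[OF vs]
  show ?thesis
    unfolding null2_def
    by (rule annihilates_span[OF vs])
      (auto simp: linear_diffD[OF F] linear_scaleD[OF F] fext_gen[OF vs]
        linear_addD[OF lin(1)] linear_scaleD[OF lin(1)] linear_addD[OF lin(2)] linear_scaleD[OF lin(2)])
qed

lemma trilin_annihilates:
  assumes lin: "\<And>y z. Vector_Spaces.linear sA s (\<lambda>x. t x y z)"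
    "\<And>x z. Vector_Spaces.linear sB s (\<lambda>y. t x y z)"
    "\<And>x y. Vector_Spaces.linear sC s (\<lambda>z. t x y z)"
  shows "annihilates s (null3 sA sB sC) (\<lambda>(x, y, z). t x y z)"
proof -
  have vs: "vector_space s" using lin(1) by (rule linear_vector_space2)
  note F = linear_fext[OF vs]
  show ?thesis
    unfolding null3_def
    by (rule annihilates_span[OF vs])
      (auto simp: linear_diffD[OF F] linear_scaleD[OF F] fext_gen[OF vs]
        linear_addD[OF lin(1)] linear_scaleD[OF lin(1)] linear_addD[OF lin(2)] linear_scaleD[OF lin(2)]
        linear_addD[OF lin(3)] linear_scaleD[OF lin(3)])
qed

lemma slift_tens2:
  assumes "bilin sA sB s h"
  shows "slift s (\<lambda>(x, y). h x y) (tens2 sA sB x y) = h x y"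
  using bilin_annihilates[OF assms] by (simp add: tens2_def slift_cls fext_gen annihilates_def)

lemma slift_sext_tens2:
  assumes "bilin sA sB s h"
  shows "slift s (\<lambda>(x, y). h x y) (sext (null2 sA sB) (\<lambda>(u, v). tens2 sA sB (f u v) (g u v)) X)
    = slift s (\<lambda>(u, v). h (f u v) (g u v)) X"
  unfolding slift_sext[OF bilin_annihilates[OF assms]]
  by (simp add: case_prod_beta' slift_tens2[OF assms, unfolded case_prod_beta'])

lemma slift_tmap:
  assumes "bilin sA sB s h"
  shows "slift s (\<lambda>(x, y). h x y) (tmap sA sB f g X) = slift s (\<lambda>(u, v). h (f u) (g v)) X"
  unfolding tmap_def by (rule slift_sext_tens2[OF assms])

lemma slift_tens3:
  assumes "annihilates s (null3 sA sB sC) h"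
  shows "slift s h (tens3 sA sB sC x y z) = h (x, y, z)"
  using assms by (simp add: tens3_def slift_cls fext_gen annihilates_def)

lemma slift_tmap21:
  assumes "annihilates s (null3 sA sB sC) h"
  shows "slift s h (tmap21 sA sB sC F g X)
    = slift s (\<lambda>(x, y). slift s (\<lambda>(u, v). h (u, v, g y)) (F x)) X"
  by (simp add: tmap21_def slift_sext[OF assms] case_prod_beta' slift_tens3[OF assms])

lemma slift_tmap12:
  assumes "annihilates s (null3 sA sB sC) h"
  shows "slift s h (tmap12 sA sB sC f G X)
    = slift s (\<lambda>(x, y). slift s (\<lambda>(u, v). h (f x, u, v)) (G y)) X"
  by (simp add: tmap12_def slift_sext[OF assms] case_prod_beta' slift_tens3[OF assms])

section \<open>Composites of linear maps, inverses of bijections and their commutation rules\<close>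

lemma linear_comp:
  "Vector_Spaces.linear t u f \<Longrightarrow> Vector_Spaces.linear s t g \<Longrightarrow> Vector_Spaces.linear s u (\<lambda>x. f (g x))"
  by (simp add: Vector_Spaces.linear_iff)

lemma linear_ident: "vector_space s \<Longrightarrow> Vector_Spaces.linear s s (\<lambda>x. x)"
  by (simp add: Vector_Spaces.linear_iff)

lemma linear_add_fun:
  assumes "Vector_Spaces.linear s t f" "Vector_Spaces.linear s t g"
  shows "Vector_Spaces.linear s t (\<lambda>x. f x + g x)"
proof -
  interpret vector_space t using assms(1) by (rule linear_vector_space2)
  show ?thesis using assms
    by (simp add: Vector_Spaces.linear_iff scale_right_distrib algebra_simps)
qed

lemma inv_bij_cancel:
  assumes "bij f"
  shows "inv f (f x) = x" "f (inv f y) = y"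
  using assms by (simp_all add: bij_is_inj bij_is_surj surj_f_inv_f)

lemma linear_inv:
  assumes "Vector_Spaces.linear s t f" "bij f"
  shows "Vector_Spaces.linear t s (inv f)"
  by (rule linearI[OF linear_vector_space2[OF assms(1)] linear_vector_space1[OF assms(1)]])
    (metis assms inv_bij_cancel linear_addD, metis assms inv_bij_cancel linear_scaleD)

lemma inv_commute:
  assumes "bij f" "bij g" "\<And>x. f (g x) = g (f x)"
  shows "f (inv g x) = inv g (f x)" "inv f (g x) = g (inv f x)" "inv f (inv g x) = inv g (inv f x)"
  by (metis assms inv_bij_cancel)+

lemma inv_distrib:
  assumes "bij f" "bij g" "bij h" "\<And>x y. f (p x y) = q (g x) (h y)"
  shows "inv f (q x y) = p (inv g x) (inv h y)"
  by (metis assms inv_bij_cancel)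

lemma bilin_comp:
  assumes "bilin sA sB s h" "Vector_Spaces.linear r sA f" "Vector_Spaces.linear t sB g"
  shows "bilin r t s (\<lambda>x y. h (f x) (g y))"
  by (intro bilinI linear_comp[OF bilin_right[OF assms(1)] assms(3)]
      linear_comp[OF bilin_left[OF assms(1)] assms(2)])

text \<open>Writing \<open>x\<close> as \<open>e (inv e x)\<close>, comultiplicativity produces
  \<open>f\<close> and \<open>g\<close> on the two legs, where they cancel \<open>inv f\<close> and
  \<open>inv g\<close>. The lemma moves an inverse from the argument of a coaction onto its
  legs.\<close>

lemma slift_inv_comult:
  assumes F: "\<And>x. tmap sA sB f g (F x) = F (e x)"
    and bij: "bij e" "bij f" "bij g"
    and lin: "Vector_Spaces.linear sA sA f" "Vector_Spaces.linear sB sB g"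
    and h: "bilin sA sB s h"
  shows "slift s (\<lambda>(u, v). h u v) (F (inv e x)) = slift s (\<lambda>(u, v). h (inv f u) (inv g v)) (F x)"
proof -
  have "slift s (\<lambda>(u, v). h (inv f u) (inv g v)) (F x)
      = slift s (\<lambda>(u, v). h (inv f u) (inv g v)) (tmap sA sB f g (F (inv e x)))"
    by (simp add: F inv_bij_cancel bij)
  also have "\<dots> = slift s (\<lambda>(u, v). h (inv f (f u)) (inv g (g v))) (F (inv e x))"
    by (rule slift_tmap) (intro bilin_comp[OF h] linear_inv lin bij)
  finally show ?thesis
    by (simp add: inv_bij_cancel bij)
qed

section \<open>Sums over the untwisted comultiplication\<close>

text \<open>
  \<open>sw s \<omega> \<psi> h (\<Delta> a)\<close> is the sum \<open>\<Sum> h a\<^sub>1 a\<^sub>2\<close> for the untwisted comultiplication \<open>(\<omega>\<^sup>-\<^sup>1 \<otimes> \<psi>\<^sup>-\<^sup>1) \<Delta>\<close>.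
\<close>

definition sw :: "('k::field \<Rightarrow> 'v::ab_group_add \<Rightarrow> 'v) \<Rightarrow> ('a \<Rightarrow> 'a) \<Rightarrow> ('b \<Rightarrow> 'b) \<Rightarrow> ('a \<Rightarrow> 'b \<Rightarrow> 'v)
    \<Rightarrow> ('k, 'a \<times> 'b) coset \<Rightarrow> 'v" where
  "sw s f g h X = slift s (\<lambda>(x, y). h (inv f x) (inv g y)) X"

lemma sw_linear_comp:
  "Vector_Spaces.linear s t L \<Longrightarrow> L (sw s f g h X) = sw t f g (\<lambda>x y. L (h x y)) X"
  by (simp add: sw_def slift_linear_comp case_prod_beta')

lemma sw_add:
  "vector_space s \<Longrightarrow> sw s f g (\<lambda>x y. h x y + k x y) X = sw s f g h X + sw s f g k X"
  by (simp add: sw_def slift_add[symmetric] case_prod_beta')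

lemma sw_scale:
  assumes "vector_space s"
  shows "sw s f g (\<lambda>x y. s c (h x y)) X = s c (sw s f g h X)"
proof -
  interpret vector_space s by fact
  show ?thesis
    by (rule sw_linear_comp[symmetric, OF linear_scale_self])
qed

lemma linear_sw_integrand:
  assumes "vector_space r" "vector_space s" "\<And>x y. Vector_Spaces.linear r s (\<lambda>v. h v x y)"
  shows "Vector_Spaces.linear r s (\<lambda>v. sw s f g (h v) X)"
  unfolding sw_def
  by (rule linear_slift_integrand[OF assms(1,2)]) (simp add: case_prod_beta' assms(3))

lemma linear_sw_qlinear:
  assumes "vector_space r" "qlinear r (null2 sA sB) F" "bilin sA sB s h"
    and "Vector_Spaces.linear sA sA f" "bij f" "Vector_Spaces.linear sB sB g" "bij g"
  shows "Vector_Spaces.linear r s (\<lambda>v. sw s f g h (F v))"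
  unfolding sw_def
  by (rule linear_slift_qlinear[OF assms(1,2)])
    (intro bilin_annihilates bilin_comp[OF assms(3)] linear_inv assms)

text \<open>The maps \<open>a\<close> and \<open>b\<close> commute with \<open>f\<close> and
  \<open>g\<close>, hence with their inverses, so comultiplicativity survives the
  untwisting.\<close>

lemma sw_comult:
  assumes F: "\<And>x. tmap sA sB a b (F x) = F (e x)"
    and "bij f" "bij g" "bij a" "bij b" "\<And>x. a (f x) = f (a x)" "\<And>x. b (g x) = g (b x)"
    and "Vector_Spaces.linear sA sA f" "Vector_Spaces.linear sB sB g"
    and h: "bilin sA sB s h"
  shows "sw s f g h (F (e x)) = sw s f g (\<lambda>u v. h (a u) (b v)) (F x)"
proof -
  have "sw s f g h (F (e x)) = slift s (\<lambda>(u, v). h (inv f u) (inv g v)) (tmap sA sB a b (F x))"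
    by (simp add: sw_def F)
  also have "\<dots> = slift s (\<lambda>(u, v). h (inv f (a u)) (inv g (b v))) (F x)"
    by (rule slift_tmap) (intro bilin_comp[OF h] linear_inv assms)
  finally show ?thesis
    using assms by (simp add: sw_def inv_commute(1))
qed

text \<open>
  The four coassociativity axioms of \<open>\<Delta>\<close>, \<open>\<rho>\<close> and \<open>\<phi>\<close> are instances, with different choices of \<open>F\<close>, \<open>G\<close>,
  \<open>X\<close> and \<open>Y\<close>.
\<close>

lemma sw_coassoc:
  assumes coassoc: "tmap21 sP sQ sR F \<psi>\<^sub>R X = tmap12 sP sQ sR \<omega>\<^sub>P G Y"
    and F: "\<And>x. tmap sP sQ \<omega>\<^sub>P \<omega>\<^sub>Q (F x) = F (\<omega>\<^sub>X x)"
    and G: "\<And>y. tmap sQ sR \<psi>\<^sub>Q \<psi>\<^sub>R (G y) = G (\<psi>\<^sub>Y y)"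
    and bij: "bij \<omega>\<^sub>P" "bij \<omega>\<^sub>Q" "bij \<omega>\<^sub>X" "bij \<psi>\<^sub>Q" "bij \<psi>\<^sub>R" "bij \<psi>\<^sub>Y"
    and comm: "\<And>q. \<psi>\<^sub>Q (\<omega>\<^sub>Q q) = \<omega>\<^sub>Q (\<psi>\<^sub>Q q)"
    and lin: "Vector_Spaces.linear sP sP \<omega>\<^sub>P" "Vector_Spaces.linear sQ sQ \<omega>\<^sub>Q"
      "Vector_Spaces.linear sQ sQ \<psi>\<^sub>Q" "Vector_Spaces.linear sR sR \<psi>\<^sub>R"
    and t: "\<And>y z. Vector_Spaces.linear sP s (\<lambda>x. t x y z)"
      "\<And>x z. Vector_Spaces.linear sQ s (\<lambda>y. t x y z)"
      "\<And>x y. Vector_Spaces.linear sR s (\<lambda>z. t x y z)"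
  shows "sw s \<omega>\<^sub>X \<psi>\<^sub>R (\<lambda>x y. sw s \<omega>\<^sub>P \<psi>\<^sub>Q (\<lambda>u v. t u v y) (F x)) X
       = sw s \<omega>\<^sub>P \<psi>\<^sub>Y (\<lambda>x y. sw s \<omega>\<^sub>Q \<psi>\<^sub>R (\<lambda>u v. t x u v) (G y)) Y"
proof -
  note inv_lin = lin(1)[THEN linear_inv, OF bij(1)] lin(2)[THEN linear_inv, OF bij(2)]
    lin(3)[THEN linear_inv, OF bij(4)] lin(4)[THEN linear_inv, OF bij(5)]
  \<comment> \<open>Besides the untwisting inverses, evaluating \<open>F\<close> at
    \<open>inv \<omega>\<^sub>X x\<close> puts \<open>inv \<omega>\<^sub>P\<close> and
    \<open>inv \<omega>\<^sub>Q\<close> on its legs, and evaluating \<open>G\<close> at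
    \<open>inv \<psi>\<^sub>Y y\<close> puts \<open>inv \<psi>\<^sub>Q\<close> and
    \<open>inv \<psi>\<^sub>R\<close> on its legs. The integrand \<open>h\<close> carries two
    inverses on each leg so that both iterated sums become values of the same \<open>h\<close>; the
    orders on the middle leg agree by \<open>comm\<close>.\<close>
  define h where "h = (\<lambda>(u, v, w). t (inv \<omega>\<^sub>P (inv \<omega>\<^sub>P u)) (inv \<psi>\<^sub>Q (inv \<omega>\<^sub>Q v)) (inv \<psi>\<^sub>R (inv \<psi>\<^sub>R w)))"
  have h: "annihilates s (null3 sP sQ sR) h"
    unfolding h_def
    by (rule trilin_annihilates)
      (rule linear_comp[OF t(1)] linear_comp[OF t(2)] linear_comp[OF t(3)],
        rule linear_comp[OF inv_lin(1) inv_lin(1)] linear_comp[OF inv_lin(3) inv_lin(2)]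
          linear_comp[OF inv_lin(4) inv_lin(4)])+
  \<comment> \<open>The two copies of \<open>\<psi>\<^sub>R\<close> compensate the inverses in the
    third slot of \<open>h\<close>. One of them cancels the untwisting of the outer leg, the other
    is the \<open>\<psi>\<^sub>R\<close> that \<open>tmap21\<close> applies there.\<close>
  have "sw s \<omega>\<^sub>P \<psi>\<^sub>Q (\<lambda>u v. t u v z) (F (inv \<omega>\<^sub>X x))
      = slift s (\<lambda>(u, v). h (u, v, \<psi>\<^sub>R (\<psi>\<^sub>R z))) (F x)" for x z
    unfolding sw_def
    by (subst slift_inv_comult[where F = F and e = \<omega>\<^sub>X, OF F bij(3,1,2) lin(1,2)])
      (rule bilinI linear_comp[OF t(1)] linear_comp[OF t(2)] inv_lin | simp add: h_def inv_bij_cancel bij)+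
  then have L: "sw s \<omega>\<^sub>X \<psi>\<^sub>R (\<lambda>x y. sw s \<omega>\<^sub>P \<psi>\<^sub>Q (\<lambda>u v. t u v y) (F x)) X
      = slift s h (tmap21 sP sQ sR F \<psi>\<^sub>R X)"
    by (simp add: slift_tmap21[OF h] sw_def[of _ \<omega>\<^sub>X] inv_bij_cancel bij)
  have "sw s \<omega>\<^sub>Q \<psi>\<^sub>R (\<lambda>u v. t x u v) (G (inv \<psi>\<^sub>Y y))
      = slift s (\<lambda>(u, v). h (\<omega>\<^sub>P (\<omega>\<^sub>P x), u, v)) (G y)" for x y
    unfolding sw_def
    by (subst slift_inv_comult[where F = G and e = \<psi>\<^sub>Y, OF G bij(6,4,5) lin(3,4)])
      (rule bilinI linear_comp[OF t(3)] linear_comp[OF t(2)] inv_lin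
        | simp add: h_def inv_bij_cancel inv_commute[where f = \<psi>\<^sub>Q and g = \<omega>\<^sub>Q, OF bij(4,2) comm] bij)+
  then have R: "sw s \<omega>\<^sub>P \<psi>\<^sub>Y (\<lambda>x y. sw s \<omega>\<^sub>Q \<psi>\<^sub>R (\<lambda>u v. t x u v) (G y)) Y
      = slift s h (tmap12 sP sQ sR \<omega>\<^sub>P G Y)"
    by (simp add: slift_tmap12[OF h] sw_def[of _ _ \<psi>\<^sub>Y] inv_bij_cancel bij)
  show ?thesis
    unfolding L R coassoc ..
qed

section \<open>The untwisted bialgebra and its bimodules\<close>

text \<open>This undoes the Yau twist: for bijective \<open>f\<close> and \<open>g\<close>,
  \<open>untwist f g p (f x) (g y)\<close> is \<open>p x y\<close>. It is stated for three types in
  order to serve the multiplication and both actions.\<close>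

definition untwist :: "('a \<Rightarrow> 'a) \<Rightarrow> ('b \<Rightarrow> 'b) \<Rightarrow> ('a \<Rightarrow> 'b \<Rightarrow> 'c) \<Rightarrow> 'a \<Rightarrow> 'b \<Rightarrow> 'c" where
  "untwist f g p x y = p (inv f x) (inv g y)"

locale bij_bialgebra = infBH_bialgebra l sA \<mu> \<Delta> \<alpha>\<^sub>A \<beta>\<^sub>A \<psi>\<^sub>A \<omega>\<^sub>A
  for l :: "'k::field"
    and sA :: "'k \<Rightarrow> 'a::ab_group_add \<Rightarrow> 'a"
    and \<mu> :: "'a \<Rightarrow> 'a \<Rightarrow> 'a" (infixl \<open>\<bullet>\<close> 70)
    and \<Delta> :: "'a \<Rightarrow> ('k, 'a \<times> 'a) coset"
    and \<alpha>\<^sub>A \<beta>\<^sub>A \<psi>\<^sub>A \<omega>\<^sub>A :: "'a \<Rightarrow> 'a" +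
  assumes bij_\<alpha>: "bij \<alpha>\<^sub>A" and bij_\<beta>: "bij \<beta>\<^sub>A" and bij_\<psi>: "bij \<psi>\<^sub>A" and bij_\<omega>: "bij \<omega>\<^sub>A"
begin

section \<open>The untwisted multiplication on A\<close>

abbreviation mul (infixl \<open>\<cdot>\<close> 70) where "(\<cdot>) \<equiv> untwist \<alpha>\<^sub>A \<beta>\<^sub>A \<mu>"

lemmas cancel_A = inv_bij_cancel[OF bij_\<alpha>] inv_bij_cancel[OF bij_\<beta>]
  inv_bij_cancel[OF bij_\<psi>] inv_bij_cancel[OF bij_\<omega>]

text \<open>As rewrite rules these put every word in the structure maps and their inverses into the
  order \<omega>, \<psi>, \<beta>, \<alpha> from outside to inside. A map and its inverse then
  become adjacent, and \<open>cancel_A\<close> removes them.\<close>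

lemmas commute_A = \<alpha>_\<beta> \<alpha>_\<psi> \<alpha>_\<omega> \<beta>_\<psi> \<beta>_\<omega> \<psi>_\<omega>
  inv_commute[where f = \<alpha>\<^sub>A and g = \<beta>\<^sub>A, OF bij_\<alpha> bij_\<beta> \<alpha>_\<beta>]
  inv_commute[where f = \<alpha>\<^sub>A and g = \<psi>\<^sub>A, OF bij_\<alpha> bij_\<psi> \<alpha>_\<psi>]
  inv_commute[where f = \<alpha>\<^sub>A and g = \<omega>\<^sub>A, OF bij_\<alpha> bij_\<omega> \<alpha>_\<omega>]
  inv_commute[where f = \<beta>\<^sub>A and g = \<psi>\<^sub>A, OF bij_\<beta> bij_\<psi> \<beta>_\<psi>]
  inv_commute[where f = \<beta>\<^sub>A and g = \<omega>\<^sub>A, OF bij_\<beta> bij_\<omega> \<beta>_\<omega>]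
  inv_commute[where f = \<psi>\<^sub>A and g = \<omega>\<^sub>A, OF bij_\<psi> bij_\<omega> \<psi>_\<omega>]

lemmas mult_A = \<alpha>_mult \<beta>_mult \<psi>_mult \<omega>_mult
  inv_distrib[where p = \<mu> and q = \<mu>, OF bij_\<alpha> bij_\<alpha> bij_\<alpha> \<alpha>_mult]
  inv_distrib[where p = \<mu> and q = \<mu>, OF bij_\<beta> bij_\<beta> bij_\<beta> \<beta>_mult]
  inv_distrib[where p = \<mu> and q = \<mu>, OF bij_\<psi> bij_\<psi> bij_\<psi> \<psi>_mult]
  inv_distrib[where p = \<mu> and q = \<mu>, OF bij_\<omega> bij_\<omega> bij_\<omega> \<omega>_mult]

lemma \<alpha>_mul: "\<alpha>\<^sub>A (a \<cdot> b) = \<alpha>\<^sub>A a \<cdot> \<alpha>\<^sub>A b" and \<beta>_mul: "\<beta>\<^sub>A (a \<cdot> b) = \<beta>\<^sub>A a \<cdot> \<beta>\<^sub>A b"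
  by (simp_all add: untwist_def mult_A commute_A cancel_A)

lemma mul_assoc: "a \<cdot> (b \<cdot> c) = (a \<cdot> b) \<cdot> c"
proof -
  \<comment> \<open>BiHom-associativity at \<alpha>^-2(a), \<alpha>^-1 \<beta>^-1(b) and
    \<beta>^-2(c): these are the inverses that two nested untwisted products put on the three
    factors, except for the one \<alpha> and the one \<beta> in the axiom. The action laws on M
    follow the same pattern.\<close>
  have "\<alpha>\<^sub>A (inv \<alpha>\<^sub>A (inv \<alpha>\<^sub>A a)) \<bullet> (inv \<beta>\<^sub>A (inv \<alpha>\<^sub>A b) \<bullet> inv \<beta>\<^sub>A (inv \<beta>\<^sub>A c))
      = (inv \<alpha>\<^sub>A (inv \<alpha>\<^sub>A a) \<bullet> inv \<beta>\<^sub>A (inv \<alpha>\<^sub>A b)) \<bullet> \<beta>\<^sub>A (inv \<beta>\<^sub>A (inv \<beta>\<^sub>A c))"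
    by (rule bihom_assoc)
  then show ?thesis
    by (simp add: untwist_def mult_A commute_A cancel_A)
qed

lemmas linear_inv_A = linear_inv[OF linear_\<alpha> bij_\<alpha>] linear_inv[OF linear_\<beta> bij_\<beta>]
  linear_inv[OF linear_\<psi> bij_\<psi>] linear_inv[OF linear_\<omega> bij_\<omega>]

lemma bilin_mul: "bilin sA sA sA (\<cdot>)"
  unfolding untwist_def by (intro bilin_comp[OF bilin_mult] linear_inv_A)

lemmas linear_mul = linear_comp[OF bilin_left[OF bilin_mul]] linear_comp[OF bilin_right[OF bilin_mul]]

lemmas sw_\<alpha>_comult = sw_comult[where F = \<Delta> and e = \<alpha>\<^sub>A and a = \<alpha>\<^sub>A and b = \<alpha>\<^sub>A and f = \<omega>\<^sub>A and g = \<psi>\<^sub>A,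
    OF \<alpha>_comult bij_\<omega> bij_\<psi> bij_\<alpha> bij_\<alpha> \<alpha>_\<omega> \<alpha>_\<psi>
    linear_\<omega> linear_\<psi>]

lemmas sw_\<beta>_comult = sw_comult[where F = \<Delta> and e = \<beta>\<^sub>A and a = \<beta>\<^sub>A and b = \<beta>\<^sub>A and f = \<omega>\<^sub>A and g = \<psi>\<^sub>A,
    OF \<beta>_comult bij_\<omega> bij_\<psi> bij_\<beta> bij_\<beta> \<beta>_\<omega> \<beta>_\<psi>
    linear_\<omega> linear_\<psi>]

end

locale bij_bimodule =
  bij_bialgebra l sA \<mu> \<Delta> \<alpha>\<^sub>A \<beta>\<^sub>A \<psi>\<^sub>A \<omega>\<^sub>A +
  bihom_bimodule sA \<mu> \<alpha>\<^sub>A \<beta>\<^sub>A sM actl actr \<alpha>\<^sub>M \<beta>\<^sub>M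
  for l :: "'k::field"
    and sA :: "'k \<Rightarrow> 'a::ab_group_add \<Rightarrow> 'a"
    and \<mu> :: "'a \<Rightarrow> 'a \<Rightarrow> 'a" (infixl \<open>\<bullet>\<close> 70)
    and \<Delta> :: "'a \<Rightarrow> ('k, 'a \<times> 'a) coset"
    and \<alpha>\<^sub>A \<beta>\<^sub>A \<psi>\<^sub>A \<omega>\<^sub>A :: "'a \<Rightarrow> 'a"
    and sM :: "'k \<Rightarrow> 'm::ab_group_add \<Rightarrow> 'm"
    and actl :: "'a \<Rightarrow> 'm \<Rightarrow> 'm" (infixr \<open>\<rhd>\<close> 70)
    and actr :: "'m \<Rightarrow> 'a \<Rightarrow> 'm" (infixl \<open>\<lhd>\<close> 70)
    and \<alpha>\<^sub>M \<beta>\<^sub>M :: "'m \<Rightarrow> 'm" +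
  assumes bij_\<alpha>\<^sub>M: "bij \<alpha>\<^sub>M" and bij_\<beta>\<^sub>M: "bij \<beta>\<^sub>M"
begin

section \<open>The untwisted actions on M\<close>

abbreviation lact (infixr \<open>\<triangleright>\<close> 70) where "(\<triangleright>) \<equiv> untwist \<alpha>\<^sub>A \<beta>\<^sub>M actl"
abbreviation ract (infixl \<open>\<triangleleft>\<close> 70) where "(\<triangleleft>) \<equiv> untwist \<alpha>\<^sub>M \<beta>\<^sub>A actr"

lemmas cancel_M = inv_bij_cancel[OF bij_\<alpha>\<^sub>M] inv_bij_cancel[OF bij_\<beta>\<^sub>M]

lemmas commute_M = \<alpha>\<^sub>M_\<beta>\<^sub>M inv_commute[where f = \<alpha>\<^sub>M and g = \<beta>\<^sub>M, OF bij_\<alpha>\<^sub>M bij_\<beta>\<^sub>M \<alpha>\<^sub>M_\<beta>\<^sub>M]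

lemmas act_M = \<alpha>\<^sub>M_actl \<beta>\<^sub>M_actl \<alpha>\<^sub>M_actr \<beta>\<^sub>M_actr
  inv_distrib[where p = actl and q = actl, OF bij_\<alpha>\<^sub>M bij_\<alpha> bij_\<alpha>\<^sub>M \<alpha>\<^sub>M_actl]
  inv_distrib[where p = actl and q = actl, OF bij_\<beta>\<^sub>M bij_\<beta> bij_\<beta>\<^sub>M \<beta>\<^sub>M_actl]
  inv_distrib[where p = actr and q = actr, OF bij_\<alpha>\<^sub>M bij_\<alpha>\<^sub>M bij_\<alpha> \<alpha>\<^sub>M_actr]
  inv_distrib[where p = actr and q = actr, OF bij_\<beta>\<^sub>M bij_\<beta>\<^sub>M bij_\<beta> \<beta>\<^sub>M_actr]

lemma \<alpha>\<^sub>M_lact: "\<alpha>\<^sub>M (a \<triangleright> m) = \<alpha>\<^sub>A a \<triangleright> \<alpha>\<^sub>M m" and \<beta>\<^sub>M_lact: "\<beta>\<^sub>M (a \<triangleright> m) = \<beta>\<^sub>A a \<triangleright> \<beta>\<^sub>M m"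
  and \<alpha>\<^sub>M_ract: "\<alpha>\<^sub>M (m \<triangleleft> a) = \<alpha>\<^sub>M m \<triangleleft> \<alpha>\<^sub>A a" and \<beta>\<^sub>M_ract: "\<beta>\<^sub>M (m \<triangleleft> a) = \<beta>\<^sub>M m \<triangleleft> \<beta>\<^sub>A a"
  by (simp_all add: untwist_def act_M commute_A cancel_A commute_M cancel_M)

lemma lact_lact: "a \<triangleright> (b \<triangleright> m) = (a \<cdot> b) \<triangleright> m"
proof -
  have "\<alpha>\<^sub>A (inv \<alpha>\<^sub>A (inv \<alpha>\<^sub>A a)) \<rhd> (inv \<beta>\<^sub>A (inv \<alpha>\<^sub>A b) \<rhd> inv \<beta>\<^sub>M (inv \<beta>\<^sub>M m))
      = (inv \<alpha>\<^sub>A (inv \<alpha>\<^sub>A a) \<bullet> inv \<beta>\<^sub>A (inv \<alpha>\<^sub>A b)) \<rhd> \<beta>\<^sub>M (inv \<beta>\<^sub>M (inv \<beta>\<^sub>M m))"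
    by (rule actl_actl)
  then show ?thesis
    by (simp add: untwist_def mult_A act_M commute_A cancel_A commute_M cancel_M)
qed

lemma ract_ract: "m \<triangleleft> (a \<cdot> b) = (m \<triangleleft> a) \<triangleleft> b"
proof -
  have "\<alpha>\<^sub>M (inv \<alpha>\<^sub>M (inv \<alpha>\<^sub>M m)) \<lhd> (inv \<beta>\<^sub>A (inv \<alpha>\<^sub>A a) \<bullet> inv \<beta>\<^sub>A (inv \<beta>\<^sub>A b))
      = (inv \<alpha>\<^sub>M (inv \<alpha>\<^sub>M m) \<lhd> inv \<beta>\<^sub>A (inv \<alpha>\<^sub>A a)) \<lhd> \<beta>\<^sub>A (inv \<beta>\<^sub>A (inv \<beta>\<^sub>A b))"
    by (rule actr_actr)
  then show ?thesis
    by (simp add: untwist_def mult_A act_M commute_A cancel_A commute_M cancel_M)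
qed

lemma lact_ract: "a \<triangleright> (m \<triangleleft> b) = (a \<triangleright> m) \<triangleleft> b"
proof -
  have "\<alpha>\<^sub>A (inv \<alpha>\<^sub>A (inv \<alpha>\<^sub>A a)) \<rhd> (inv \<beta>\<^sub>M (inv \<alpha>\<^sub>M m) \<lhd> inv \<beta>\<^sub>A (inv \<beta>\<^sub>A b))
      = (inv \<alpha>\<^sub>A (inv \<alpha>\<^sub>A a) \<rhd> inv \<beta>\<^sub>M (inv \<alpha>\<^sub>M m)) \<lhd> \<beta>\<^sub>A (inv \<beta>\<^sub>A (inv \<beta>\<^sub>A b))"
    by (rule actl_actr)
  then show ?thesis
    by (simp add: untwist_def mult_A act_M commute_A cancel_A commute_M cancel_M)
qed

lemma bilin_lact: "bilin sA sM sM (\<triangleright>)" and bilin_ract: "bilin sM sA sM (\<triangleleft>)"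
  unfolding untwist_def
  by (intro bilin_comp[OF bilin_actl] bilin_comp[OF bilin_actr] linear_inv_A
      linear_inv[OF linear_\<alpha>\<^sub>M bij_\<alpha>\<^sub>M] linear_inv[OF linear_\<beta>\<^sub>M bij_\<beta>\<^sub>M])+

lemmas linear_act = linear_mul
  linear_comp[OF bilin_left[OF bilin_lact]] linear_comp[OF bilin_right[OF bilin_lact]]
  linear_comp[OF bilin_left[OF bilin_ract]] linear_comp[OF bilin_right[OF bilin_ract]]
  linear_ident[OF vector_space_A] linear_ident[OF vector_space_M]

section \<open>The right operation of A on M\<close>

abbreviation sw\<^sub>\<Delta> where "sw\<^sub>\<Delta> h a \<equiv> sw sM \<omega>\<^sub>A \<psi>\<^sub>A h (\<Delta> a)"

text \<open>In untwisted terms this is a_1 m a_2. It is built from the comultiplication of A and the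
  two actions, without the coactions of M, so that M = A can be substituted.\<close>

definition circ :: "'m \<Rightarrow> 'a \<Rightarrow> 'm" where
  "circ m a = sw sM \<omega>\<^sub>A \<psi>\<^sub>A (\<lambda>x y. (x \<triangleright> m) \<triangleleft> y) (\<Delta> a)"

lemma bilin_circ: "bilin sM sA sM circ"
  unfolding circ_def
  by (intro bilinI linear_sw_integrand linear_sw_qlinear[OF vector_space_A linear_\<Delta>]
      linear_\<omega> linear_\<psi> bij_\<omega> bij_\<psi> linear_act vector_space_M)

text \<open>The summands come from the three terms of \<Delta>(ab): in a b_1 \<otimes> b_2 the
  factor \<open>a\<close> comes out on the left, in a_1 \<otimes> a_2 b the factor \<open>b\<close>
  comes out on the right, and the \<lambda> term places \<open>m\<close> between \<open>a\<close>
  and \<open>b\<close>.\<close>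

lemma circ_mul: "circ m (a \<cdot> b) = a \<triangleright> circ m b + circ m a \<triangleleft> b + sM l ((a \<triangleright> m) \<triangleleft> b)"
proof -
  \<comment> \<open>\<open>H\<close> absorbs the untwisting inverses, so that the compatibility
    axiom for the original \<Delta> and product can be inserted directly.\<close>
  define H where "H = (\<lambda>x y. (inv \<omega>\<^sub>A x \<triangleright> m) \<triangleleft> inv \<psi>\<^sub>A y)"
  have H: "bilin sA sA sM H"
    unfolding H_def by (intro bilinI linear_act linear_inv_A)
  have H1: "bilin sA sA sM (\<lambda>x y. H (\<omega>\<^sub>A (inv \<alpha>\<^sub>A a) \<bullet> x) (\<beta>\<^sub>A y))"
    by (intro bilin_comp[OF H] bilin_right[OF bilin_mult] linear_\<beta>)
  have H2: "bilin sA sA sM (\<lambda>x y. H (\<alpha>\<^sub>A x) (y \<bullet> \<psi>\<^sub>A (inv \<beta>\<^sub>A b)))"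
    by (intro bilin_comp[OF H] bilin_left[OF bilin_mult] linear_\<alpha>)
  have "circ m (a \<cdot> b) = slift sM (\<lambda>(x, y). H x y) (\<Delta> (inv \<alpha>\<^sub>A a \<bullet> inv \<beta>\<^sub>A b))"
    by (simp add: circ_def sw_def H_def untwist_def)
  also have "\<dots> = slift sM (\<lambda>(x, y). H (\<omega>\<^sub>A (inv \<alpha>\<^sub>A a) \<bullet> x) (\<beta>\<^sub>A y)) (\<Delta> (inv \<beta>\<^sub>A b))
      + slift sM (\<lambda>(x, y). H (\<alpha>\<^sub>A x) (y \<bullet> \<psi>\<^sub>A (inv \<beta>\<^sub>A b))) (\<Delta> (inv \<alpha>\<^sub>A a))
      + sM l (H (\<alpha>\<^sub>A (\<omega>\<^sub>A (inv \<alpha>\<^sub>A a))) (\<beta>\<^sub>A (\<psi>\<^sub>A (inv \<beta>\<^sub>A b))))"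
    unfolding comult_mult slift_qadd[OF bilin_annihilates[OF H]] slift_qscale[OF bilin_annihilates[OF H]]
      slift_sext_tens2[OF H] slift_tens2[OF H] ..
  also have "slift sM (\<lambda>(x, y). H (\<omega>\<^sub>A (inv \<alpha>\<^sub>A a) \<bullet> x) (\<beta>\<^sub>A y)) (\<Delta> (inv \<beta>\<^sub>A b))
      = sw\<^sub>\<Delta> (\<lambda>x y. a \<triangleright> ((x \<triangleright> m) \<triangleleft> y)) b"
    unfolding slift_inv_comult[where F = \<Delta> and e = \<beta>\<^sub>A, OF \<beta>_comult bij_\<beta> bij_\<beta> bij_\<beta> linear_\<beta> linear_\<beta> H1]
    unfolding sw_def H_def lact_ract lact_lact
    by (simp add: untwist_def mult_A commute_A cancel_A)
  also have "\<dots> = a \<triangleright> circ m b"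
    unfolding circ_def by (rule sw_linear_comp[symmetric, OF bilin_right[OF bilin_lact]])
  also have "slift sM (\<lambda>(x, y). H (\<alpha>\<^sub>A x) (y \<bullet> \<psi>\<^sub>A (inv \<beta>\<^sub>A b))) (\<Delta> (inv \<alpha>\<^sub>A a))
      = sw\<^sub>\<Delta> (\<lambda>x y. ((x \<triangleright> m) \<triangleleft> y) \<triangleleft> b) a"
    unfolding slift_inv_comult[where F = \<Delta> and e = \<alpha>\<^sub>A, OF \<alpha>_comult bij_\<alpha> bij_\<alpha> bij_\<alpha> linear_\<alpha> linear_\<alpha> H2]
    unfolding sw_def H_def ract_ract[symmetric]
    by (simp add: untwist_def mult_A commute_A cancel_A)
  also have "\<dots> = circ m a \<triangleleft> b"
    unfolding circ_def by (rule sw_linear_comp[symmetric, OF bilin_left[OF bilin_ract]])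
  also have "H (\<alpha>\<^sub>A (\<omega>\<^sub>A (inv \<alpha>\<^sub>A a))) (\<beta>\<^sub>A (\<psi>\<^sub>A (inv \<beta>\<^sub>A b))) = (a \<triangleright> m) \<triangleleft> b"
    by (simp add: H_def commute_A cancel_A)
  finally show ?thesis .
qed

lemma sw_coassoc_\<Delta>:
  assumes "\<And>y z. Vector_Spaces.linear sA sM (\<lambda>x. t x y z)"
      "\<And>x z. Vector_Spaces.linear sA sM (\<lambda>y. t x y z)"
      "\<And>x y. Vector_Spaces.linear sA sM (\<lambda>z. t x y z)"
  shows "sw\<^sub>\<Delta> (\<lambda>x y. sw\<^sub>\<Delta> (\<lambda>u v. t u v y) x) c = sw\<^sub>\<Delta> (\<lambda>x y. sw\<^sub>\<Delta> (\<lambda>u v. t x u v) y) c"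
  by (rule sw_coassoc[where F = \<Delta> and G = \<Delta> and t = t and \<omega>\<^sub>P = \<omega>\<^sub>A and \<omega>\<^sub>Q = \<omega>\<^sub>A and \<omega>\<^sub>X = \<omega>\<^sub>A
        and \<psi>\<^sub>Q = \<psi>\<^sub>A and \<psi>\<^sub>R = \<psi>\<^sub>A and \<psi>\<^sub>Y = \<psi>\<^sub>A,
        OF bihom_coassoc \<omega>_comult \<psi>_comult bij_\<omega> bij_\<omega> bij_\<omega> bij_\<psi> bij_\<psi> bij_\<psi> \<psi>_\<omega>
        linear_\<omega> linear_\<omega> linear_\<psi> linear_\<psi> assms])

lemma \<alpha>\<^sub>M_circ: "\<alpha>\<^sub>M (circ m a) = circ (\<alpha>\<^sub>M m) (\<alpha>\<^sub>A a)"
  unfolding circ_def sw_linear_comp[OF linear_\<alpha>\<^sub>M] \<alpha>\<^sub>M_ract \<alpha>\<^sub>M_lact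
  by (subst sw_\<alpha>_comult) (intro bilinI linear_act refl)+

lemma \<beta>\<^sub>M_circ: "\<beta>\<^sub>M (circ m a) = circ (\<beta>\<^sub>M m) (\<beta>\<^sub>A a)"
  unfolding circ_def sw_linear_comp[OF linear_\<beta>\<^sub>M] \<beta>\<^sub>M_ract \<beta>\<^sub>M_lact
  by (subst sw_\<beta>_comult) (intro bilinI linear_act refl)+

text \<open>An original action is an untwisted one with \<alpha> applied to its first argument and
  \<beta> to its second. Doing this twice cancels \<alpha>^-2 on the first leg and turns \<beta>^-1
  on \<open>m\<close> into \<alpha>; the \<beta> left on both legs comes from the comultiplication
  of \<beta>(a).\<close>

lemma star_circ:
  "slift sM (\<lambda>(a1, a2). (inv \<alpha>\<^sub>A (inv \<alpha>\<^sub>A (\<beta>\<^sub>A (inv \<omega>\<^sub>A a1))) \<rhd> inv \<beta>\<^sub>M m) \<lhd> inv \<psi>\<^sub>A a2) (\<Delta> a)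
    = circ (\<alpha>\<^sub>M m) (\<beta>\<^sub>A a)" (is "?L = _")
proof -
  have "?L = sw\<^sub>\<Delta> (\<lambda>x y. (\<beta>\<^sub>A x \<triangleright> \<alpha>\<^sub>M m) \<triangleleft> \<beta>\<^sub>A y) a"
    by (simp add: sw_def untwist_def act_M commute_A cancel_A commute_M cancel_M)
  also have "\<dots> = circ (\<alpha>\<^sub>M m) (\<beta>\<^sub>A a)"
    unfolding circ_def
    by (subst sw_\<beta>_comult) (intro bilinI linear_act refl)+
  finally show ?thesis .
qed

end

text \<open>
  \<open>A\<close> is a bimodule over itself, so the results on \<open>circ\<close> below cover both \<open>a \<star> b\<close> and \<open>m \<star> a\<close>.  It is not
  a Hopf bimodule over itself.
\<close>

sublocale bij_bialgebra \<subseteq> self: bij_bimodule l sA \<mu> \<Delta> \<alpha>\<^sub>A \<beta>\<^sub>A \<psi>\<^sub>A \<omega>\<^sub>A sA \<mu> \<mu> \<alpha>\<^sub>A \<beta>\<^sub>A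
  by (intro bij_bimodule.intro bihom_bimodule.intro bihom_bimodule_axioms.intro
      bij_bimodule_axioms.intro bij_bialgebra_axioms bihom_assoc_algebra_axioms vector_space_A bilin_mult
      linear_\<alpha> linear_\<beta> \<alpha>_\<beta> \<alpha>_mult \<beta>_mult bihom_assoc bij_\<alpha> bij_\<beta>)

abbreviation (in bij_bialgebra) circ_A (infixl \<open>\<circ>\<^sub>A\<close> 70) where "(\<circ>\<^sub>A) \<equiv> self.circ"

context bij_bimodule
begin

section \<open>Iterating the right operation, and the pre-Lie identity on A\<close>

lemmas ract_add = linear_addD[OF bilin_left[OF bilin_ract]] linear_addD[OF bilin_right[OF bilin_ract]]
  and ract_scale = linear_scaleD[OF bilin_left[OF bilin_ract]] linear_scaleD[OF bilin_right[OF bilin_ract]]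
  and lact_add = linear_addD[OF bilin_left[OF bilin_lact]] linear_addD[OF bilin_right[OF bilin_lact]]
  and lact_scale = linear_scaleD[OF bilin_left[OF bilin_lact]] linear_scaleD[OF bilin_right[OF bilin_lact]]

text \<open>Both sides are c_1 m c_2 a c_3: on the left the second leg of the coproduct is split
  again, on the right the first.\<close>

lemma coassoc_ract_circ: "sw\<^sub>\<Delta> (\<lambda>x y. (x \<triangleright> m) \<triangleleft> (a \<circ>\<^sub>A y)) c = sw\<^sub>\<Delta> (\<lambda>x y. (circ m x \<triangleleft> a) \<triangleleft> y) c"
proof -
  have "(x \<triangleright> m) \<triangleleft> (a \<circ>\<^sub>A y) = sw\<^sub>\<Delta> (\<lambda>u v. (((x \<triangleright> m) \<triangleleft> u) \<triangleleft> a) \<triangleleft> v) y" for x y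
    unfolding self.circ_def sw_linear_comp[OF bilin_right[OF bilin_ract]] ract_ract ..
  moreover have "(circ m x \<triangleleft> a) \<triangleleft> y = sw\<^sub>\<Delta> (\<lambda>u v. (((u \<triangleright> m) \<triangleleft> v) \<triangleleft> a) \<triangleleft> y) x" for x y
    unfolding circ_def sw_linear_comp[OF bilin_left[OF bilin_ract]] ..
  moreover have "sw\<^sub>\<Delta> (\<lambda>x y. sw\<^sub>\<Delta> (\<lambda>u v. (((u \<triangleright> m) \<triangleleft> v) \<triangleleft> a) \<triangleleft> y) x) c
      = sw\<^sub>\<Delta> (\<lambda>x y. sw\<^sub>\<Delta> (\<lambda>u v. (((x \<triangleright> m) \<triangleleft> u) \<triangleleft> a) \<triangleleft> v) y) c"
    by (rule sw_coassoc_\<Delta>) (intro linear_act)+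
  ultimately show ?thesis
    by simp
qed

text \<open>Both sides are c_1 a c_2 m c_3, with the first leg split again on the left and the
  second on the right.\<close>

lemma coassoc_lact_circ: "sw\<^sub>\<Delta> (\<lambda>x y. ((a \<circ>\<^sub>A x) \<triangleright> m) \<triangleleft> y) c = sw\<^sub>\<Delta> (\<lambda>x y. (x \<cdot> a) \<triangleright> circ m y) c"
proof -
  have "(x \<cdot> a) \<triangleright> circ m y = sw\<^sub>\<Delta> (\<lambda>u v. ((((x \<cdot> a) \<cdot> u) \<triangleright> m) \<triangleleft> v)) y" for x y
    unfolding circ_def sw_linear_comp[OF bilin_right[OF bilin_lact]] lact_ract lact_lact ..
  moreover have "((a \<circ>\<^sub>A x) \<triangleright> m) \<triangleleft> y = sw\<^sub>\<Delta> (\<lambda>u v. (((u \<cdot> a) \<cdot> v) \<triangleright> m) \<triangleleft> y) x" for x y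
    unfolding self.circ_def sw_linear_comp[OF bilin_left[OF bilin_lact]] sw_linear_comp[OF bilin_left[OF bilin_ract]] ..
  moreover have "sw\<^sub>\<Delta> (\<lambda>x y. sw\<^sub>\<Delta> (\<lambda>u v. (((u \<cdot> a) \<cdot> v) \<triangleright> m) \<triangleleft> y) x) c
      = sw\<^sub>\<Delta> (\<lambda>x y. sw\<^sub>\<Delta> (\<lambda>u v. ((((x \<cdot> a) \<cdot> u) \<triangleright> m) \<triangleleft> v)) y) c"
    by (rule sw_coassoc_\<Delta>) (intro linear_act)+
  ultimately show ?thesis
    by simp
qed

text \<open>By \<open>circ_mul\<close>, \<open>circ m\<close> is a derivation up to a \<lambda>
  term. Applied to c_1 a c_2 it gives one term for each factor and two \<lambda> terms; the term of
  the middle factor is \<open>circ (circ m a) c\<close>.\<close>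

lemma circ_circ_A:
  "circ m (a \<circ>\<^sub>A c) = circ (circ m a) c + sw\<^sub>\<Delta> (\<lambda>x y. (x \<cdot> a) \<triangleright> circ m y) c
    + sw\<^sub>\<Delta> (\<lambda>x y. (circ m x \<triangleleft> a) \<triangleleft> y) c
    + sM l (sw\<^sub>\<Delta> (\<lambda>x y. ((x \<cdot> a) \<triangleright> m) \<triangleleft> y) c + sw\<^sub>\<Delta> (\<lambda>x y. ((x \<triangleright> m) \<triangleleft> a) \<triangleleft> y) c)"
proof -
  interpret M: vector_space sM by (rule vector_space_M)
  have "circ m (a \<circ>\<^sub>A c) = sw\<^sub>\<Delta> (\<lambda>x y. circ m ((x \<cdot> a) \<cdot> y)) c"
    unfolding self.circ_def by (rule sw_linear_comp[OF bilin_right[OF bilin_circ]])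
  then show ?thesis
    by (simp add: circ_mul ract_add ract_scale sw_add[OF vector_space_M] sw_scale[OF vector_space_M]
        M.scale_right_distrib circ_def[of "circ m a"] add_ac)
qed

end

lemma (in bij_bialgebra) pre_lie_circ:
  "self.circ a (self.circ b c) - self.circ (self.circ a b) c
    = self.circ b (self.circ a c) - self.circ (self.circ b a) c"
  unfolding self.circ_circ_A self.coassoc_ract_circ by (simp add: algebra_simps)

section \<open>The untwisted Hopf bimodule\<close>

locale bij_hopf_bimodule =
  infBH_hopf_bimodule l sA \<mu> \<Delta> \<alpha>\<^sub>A \<beta>\<^sub>A \<psi>\<^sub>A \<omega>\<^sub>A sM actl actr \<rho> \<phi> \<alpha>\<^sub>M \<beta>\<^sub>M \<psi>\<^sub>M \<omega>\<^sub>M +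
  bij_bimodule l sA \<mu> \<Delta> \<alpha>\<^sub>A \<beta>\<^sub>A \<psi>\<^sub>A \<omega>\<^sub>A sM actl actr \<alpha>\<^sub>M \<beta>\<^sub>M
  for l :: "'k::field"
    and sA :: "'k \<Rightarrow> 'a::ab_group_add \<Rightarrow> 'a"
    and \<mu> :: "'a \<Rightarrow> 'a \<Rightarrow> 'a" (infixl \<open>\<bullet>\<close> 70)
    and \<Delta> :: "'a \<Rightarrow> ('k, 'a \<times> 'a) coset"
    and \<alpha>\<^sub>A \<beta>\<^sub>A \<psi>\<^sub>A \<omega>\<^sub>A :: "'a \<Rightarrow> 'a"
    and sM :: "'k \<Rightarrow> 'm::ab_group_add \<Rightarrow> 'm"
    and actl :: "'a \<Rightarrow> 'm \<Rightarrow> 'm" (infixr \<open>\<rhd>\<close> 70)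
    and actr :: "'m \<Rightarrow> 'a \<Rightarrow> 'm" (infixl \<open>\<lhd>\<close> 70)
    and \<rho> :: "'m \<Rightarrow> ('k, 'a \<times> 'm) coset"
    and \<phi> :: "'m \<Rightarrow> ('k, 'm \<times> 'a) coset"
    and \<alpha>\<^sub>M \<beta>\<^sub>M \<psi>\<^sub>M \<omega>\<^sub>M :: "'m \<Rightarrow> 'm" +
  assumes bij_\<psi>\<^sub>M: "bij \<psi>\<^sub>M" and bij_\<omega>\<^sub>M: "bij \<omega>\<^sub>M"
    and compatible: "hopf_bimodule_maps_compatible sA \<alpha>\<^sub>A \<beta>\<^sub>A \<psi>\<^sub>A \<omega>\<^sub>A sM actl actr \<rho> \<phi> \<alpha>\<^sub>M \<beta>\<^sub>M \<psi>\<^sub>M \<omega>\<^sub>M"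
begin

lemma \<alpha>\<^sub>M_\<rho>: "tmap sA sM \<alpha>\<^sub>A \<alpha>\<^sub>M (\<rho> m) = \<rho> (\<alpha>\<^sub>M m)"
  and \<beta>\<^sub>M_\<rho>: "tmap sA sM \<beta>\<^sub>A \<beta>\<^sub>M (\<rho> m) = \<rho> (\<beta>\<^sub>M m)"
  and \<alpha>\<^sub>M_\<phi>: "tmap sM sA \<alpha>\<^sub>M \<alpha>\<^sub>A (\<phi> m) = \<phi> (\<alpha>\<^sub>M m)"
  and \<beta>\<^sub>M_\<phi>: "tmap sM sA \<beta>\<^sub>M \<beta>\<^sub>A (\<phi> m) = \<phi> (\<beta>\<^sub>M m)"
  and \<psi>\<^sub>M_actl: "\<psi>\<^sub>M (a \<rhd> m) = \<psi>\<^sub>A a \<rhd> \<psi>\<^sub>M m"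
  and \<omega>\<^sub>M_actl: "\<omega>\<^sub>M (a \<rhd> m) = \<omega>\<^sub>A a \<rhd> \<omega>\<^sub>M m"
  and \<psi>\<^sub>M_actr: "\<psi>\<^sub>M (m \<lhd> a) = \<psi>\<^sub>M m \<lhd> \<psi>\<^sub>A a"
  and \<omega>\<^sub>M_actr: "\<omega>\<^sub>M (m \<lhd> a) = \<omega>\<^sub>M m \<lhd> \<omega>\<^sub>A a"
  using compatible by (simp_all add: hopf_bimodule_maps_compatible_def)

lemmas cancel_H = cancel_M inv_bij_cancel[OF bij_\<psi>\<^sub>M] inv_bij_cancel[OF bij_\<omega>\<^sub>M]

lemmas commute_H = commute_M \<alpha>\<^sub>M_\<psi>\<^sub>M \<alpha>\<^sub>M_\<omega>\<^sub>M \<beta>\<^sub>M_\<psi>\<^sub>M \<beta>\<^sub>M_\<omega>\<^sub>M \<psi>\<^sub>M_\<omega>\<^sub>M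
  inv_commute[where f = \<alpha>\<^sub>M and g = \<psi>\<^sub>M, OF bij_\<alpha>\<^sub>M bij_\<psi>\<^sub>M \<alpha>\<^sub>M_\<psi>\<^sub>M]
  inv_commute[where f = \<alpha>\<^sub>M and g = \<omega>\<^sub>M, OF bij_\<alpha>\<^sub>M bij_\<omega>\<^sub>M \<alpha>\<^sub>M_\<omega>\<^sub>M]
  inv_commute[where f = \<beta>\<^sub>M and g = \<psi>\<^sub>M, OF bij_\<beta>\<^sub>M bij_\<psi>\<^sub>M \<beta>\<^sub>M_\<psi>\<^sub>M]
  inv_commute[where f = \<beta>\<^sub>M and g = \<omega>\<^sub>M, OF bij_\<beta>\<^sub>M bij_\<omega>\<^sub>M \<beta>\<^sub>M_\<omega>\<^sub>M]
  inv_commute[where f = \<psi>\<^sub>M and g = \<omega>\<^sub>M, OF bij_\<psi>\<^sub>M bij_\<omega>\<^sub>M \<psi>\<^sub>M_\<omega>\<^sub>M]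

lemmas act_H = act_M \<psi>\<^sub>M_actl \<omega>\<^sub>M_actl \<psi>\<^sub>M_actr \<omega>\<^sub>M_actr
  inv_distrib[where p = actl and q = actl, OF bij_\<psi>\<^sub>M bij_\<psi> bij_\<psi>\<^sub>M \<psi>\<^sub>M_actl]
  inv_distrib[where p = actl and q = actl, OF bij_\<omega>\<^sub>M bij_\<omega> bij_\<omega>\<^sub>M \<omega>\<^sub>M_actl]
  inv_distrib[where p = actr and q = actr, OF bij_\<psi>\<^sub>M bij_\<psi>\<^sub>M bij_\<psi> \<psi>\<^sub>M_actr]
  inv_distrib[where p = actr and q = actr, OF bij_\<omega>\<^sub>M bij_\<omega>\<^sub>M bij_\<omega> \<omega>\<^sub>M_actr]

lemmas simps_H = untwist_def mult_A act_H commute_A cancel_A commute_H cancel_H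

lemmas linear_inv_H = linear_inv_A linear_inv[OF linear_\<psi>\<^sub>M bij_\<psi>\<^sub>M] linear_inv[OF linear_\<omega>\<^sub>M bij_\<omega>\<^sub>M]

section \<open>The left operation of A on M\<close>

abbreviation sw\<^sub>\<rho> where "sw\<^sub>\<rho> h m \<equiv> sw sM \<omega>\<^sub>A \<psi>\<^sub>M h (\<rho> m)"
abbreviation sw\<^sub>\<phi> where "sw\<^sub>\<phi> h m \<equiv> sw sM \<omega>\<^sub>M \<psi>\<^sub>A h (\<phi> m)"

text \<open>This is m_1 a m_2 with \<rho> and \<phi> together in the place of a comultiplication of
  \<open>m\<close>, so the factor from M appears on either side of \<open>a\<close>.\<close>

definition circl :: "'a \<Rightarrow> 'm \<Rightarrow> 'm" where
  "circl a m = sw\<^sub>\<rho> (\<lambda>x y. (x \<cdot> a) \<triangleright> y) m + sw\<^sub>\<phi> (\<lambda>x y. (x \<triangleleft> a) \<triangleleft> y) m"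

lemma bilin_circl: "bilin sA sM sM circl"
  unfolding circl_def
  by (intro bilinI linear_add_fun linear_sw_integrand linear_sw_qlinear[OF vector_space_M linear_\<rho>]
      linear_sw_qlinear[OF vector_space_M linear_\<phi>] linear_\<omega> linear_\<psi> bij_\<omega> bij_\<psi>
      linear_\<omega>\<^sub>M linear_\<psi>\<^sub>M bij_\<omega>\<^sub>M bij_\<psi>\<^sub>M linear_act vector_space_A vector_space_M)

text \<open>The axiom for \<rho> contributes three terms: \<open>b\<close> times the \<rho> part,
  the term from \<Delta>(b), and the \<lambda> term. The axiom for \<phi> contributes only
  \<open>b\<close> times the \<phi> part. The two multiples of \<open>b\<close> recombine to
  \<open>b \<triangleright> circl a m\<close>.\<close>

lemma circl_lact: "circl a (b \<triangleright> m) = b \<triangleright> circl a m + (a \<circ>\<^sub>A b) \<triangleright> m + sM l ((b \<cdot> a) \<triangleright> m)"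
proof -
  define H where "H = (\<lambda>x y. (inv \<omega>\<^sub>A x \<cdot> a) \<triangleright> inv \<psi>\<^sub>M y)"
  define K where "K = (\<lambda>x y. (inv \<omega>\<^sub>M x \<triangleleft> a) \<triangleleft> inv \<psi>\<^sub>A y)"
  have H: "bilin sA sM sM H" and K: "bilin sM sA sM K"
    unfolding H_def K_def by (intro bilinI linear_act linear_inv_H)+
  have H1: "bilin sA sM sM (\<lambda>x y. H (\<omega>\<^sub>A (inv \<alpha>\<^sub>A b) \<bullet> x) (\<beta>\<^sub>M y))"
    by (intro bilin_comp[OF H] bilin_right[OF bilin_mult] linear_\<beta>\<^sub>M)
  have H2: "bilin sA sA sM (\<lambda>x y. H (\<alpha>\<^sub>A x) (y \<rhd> \<psi>\<^sub>M (inv \<beta>\<^sub>M m)))"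
    by (intro bilin_comp[OF H] bilin_left[OF bilin_actl] linear_\<alpha>)
  have K1: "bilin sM sA sM (\<lambda>x y. K (\<omega>\<^sub>A (inv \<alpha>\<^sub>A b) \<rhd> x) (\<beta>\<^sub>A y))"
    by (intro bilin_comp[OF K] bilin_right[OF bilin_actl] linear_\<beta>)
  have "sw\<^sub>\<rho> (\<lambda>x y. (x \<cdot> a) \<triangleright> y) (b \<triangleright> m) = slift sM (\<lambda>(x, y). H x y) (\<rho> (inv \<alpha>\<^sub>A b \<rhd> inv \<beta>\<^sub>M m))"
    by (simp add: sw_def H_def untwist_def)
  also have "\<dots> = slift sM (\<lambda>(x, y). H (\<omega>\<^sub>A (inv \<alpha>\<^sub>A b) \<bullet> x) (\<beta>\<^sub>M y)) (\<rho> (inv \<beta>\<^sub>M m))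
      + slift sM (\<lambda>(x, y). H (\<alpha>\<^sub>A x) (y \<rhd> \<psi>\<^sub>M (inv \<beta>\<^sub>M m))) (\<Delta> (inv \<alpha>\<^sub>A b))
      + sM l (H (\<alpha>\<^sub>A (\<omega>\<^sub>A (inv \<alpha>\<^sub>A b))) (\<beta>\<^sub>M (\<psi>\<^sub>M (inv \<beta>\<^sub>M m))))"
    unfolding \<rho>_actl slift_qadd[OF bilin_annihilates[OF H]] slift_qscale[OF bilin_annihilates[OF H]]
      slift_sext_tens2[OF H] slift_tens2[OF H] ..
  also have "slift sM (\<lambda>(x, y). H (\<omega>\<^sub>A (inv \<alpha>\<^sub>A b) \<bullet> x) (\<beta>\<^sub>M y)) (\<rho> (inv \<beta>\<^sub>M m))
      = sw\<^sub>\<rho> (\<lambda>x y. b \<triangleright> ((x \<cdot> a) \<triangleright> y)) m"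
    unfolding slift_inv_comult[where F = \<rho> and e = \<beta>\<^sub>M, OF \<beta>\<^sub>M_\<rho> bij_\<beta>\<^sub>M bij_\<beta> bij_\<beta>\<^sub>M linear_\<beta> linear_\<beta>\<^sub>M H1]
    unfolding sw_def H_def lact_lact mul_assoc
    by (simp add: simps_H)
  also have "\<dots> = b \<triangleright> sw\<^sub>\<rho> (\<lambda>x y. (x \<cdot> a) \<triangleright> y) m"
    by (rule sw_linear_comp[symmetric, OF bilin_right[OF bilin_lact]])
  also have "slift sM (\<lambda>(x, y). H (\<alpha>\<^sub>A x) (y \<rhd> \<psi>\<^sub>M (inv \<beta>\<^sub>M m))) (\<Delta> (inv \<alpha>\<^sub>A b))
      = sw\<^sub>\<Delta> (\<lambda>x y. ((x \<cdot> a) \<cdot> y) \<triangleright> m) b"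
    unfolding slift_inv_comult[where F = \<Delta> and e = \<alpha>\<^sub>A, OF \<alpha>_comult bij_\<alpha> bij_\<alpha> bij_\<alpha> linear_\<alpha> linear_\<alpha> H2]
    unfolding sw_def H_def lact_lact[symmetric]
    by (simp add: simps_H)
  also have "\<dots> = (a \<circ>\<^sub>A b) \<triangleright> m"
    unfolding self.circ_def by (rule sw_linear_comp[symmetric, OF bilin_left[OF bilin_lact]])
  also have "H (\<alpha>\<^sub>A (\<omega>\<^sub>A (inv \<alpha>\<^sub>A b))) (\<beta>\<^sub>M (\<psi>\<^sub>M (inv \<beta>\<^sub>M m))) = (b \<cdot> a) \<triangleright> m"
    by (simp add: H_def commute_A cancel_A commute_H cancel_H)
  finally have R: "sw\<^sub>\<rho> (\<lambda>x y. (x \<cdot> a) \<triangleright> y) (b \<triangleright> m)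
    = b \<triangleright> sw\<^sub>\<rho> (\<lambda>x y. (x \<cdot> a) \<triangleright> y) m + (a \<circ>\<^sub>A b) \<triangleright> m + sM l ((b \<cdot> a) \<triangleright> m)" .
  have "sw\<^sub>\<phi> (\<lambda>x y. (x \<triangleleft> a) \<triangleleft> y) (b \<triangleright> m) = slift sM (\<lambda>(x, y). K x y) (\<phi> (inv \<alpha>\<^sub>A b \<rhd> inv \<beta>\<^sub>M m))"
    by (simp add: sw_def K_def untwist_def)
  also have "\<dots> = slift sM (\<lambda>(x, y). K (\<omega>\<^sub>A (inv \<alpha>\<^sub>A b) \<rhd> x) (\<beta>\<^sub>A y)) (\<phi> (inv \<beta>\<^sub>M m))"
    unfolding \<phi>_actl slift_sext_tens2[OF K] ..
  also have "\<dots> = sw\<^sub>\<phi> (\<lambda>x y. b \<triangleright> ((x \<triangleleft> a) \<triangleleft> y)) m"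
    unfolding slift_inv_comult[where F = \<phi> and e = \<beta>\<^sub>M, OF \<beta>\<^sub>M_\<phi> bij_\<beta>\<^sub>M bij_\<beta>\<^sub>M bij_\<beta> linear_\<beta>\<^sub>M linear_\<beta> K1]
    unfolding sw_def K_def lact_ract
    by (simp add: simps_H)
  also have "\<dots> = b \<triangleright> sw\<^sub>\<phi> (\<lambda>x y. (x \<triangleleft> a) \<triangleleft> y) m"
    by (rule sw_linear_comp[symmetric, OF bilin_right[OF bilin_lact]])
  finally show ?thesis
    unfolding circl_def R by (simp add: lact_add add_ac)
qed

text \<open>Mirror image of \<open>circl_lact\<close>: now \<phi> contributes three terms and \<rho>
  a single one.\<close>

lemma circl_ract: "circl a (m \<triangleleft> b) = circl a m \<triangleleft> b + m \<triangleleft> (a \<circ>\<^sub>A b) + sM l ((m \<triangleleft> a) \<triangleleft> b)"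
proof -
  define H where "H = (\<lambda>x y. (inv \<omega>\<^sub>A x \<cdot> a) \<triangleright> inv \<psi>\<^sub>M y)"
  define K where "K = (\<lambda>x y. (inv \<omega>\<^sub>M x \<triangleleft> a) \<triangleleft> inv \<psi>\<^sub>A y)"
  have H: "bilin sA sM sM H" and K: "bilin sM sA sM K"
    unfolding H_def K_def by (intro bilinI linear_act linear_inv_H)+
  have K1: "bilin sA sA sM (\<lambda>x y. K (\<omega>\<^sub>M (inv \<alpha>\<^sub>M m) \<lhd> x) (\<beta>\<^sub>A y))"
    by (intro bilin_comp[OF K] bilin_right[OF bilin_actr] linear_\<beta>)
  have K2: "bilin sM sA sM (\<lambda>x y. K (\<alpha>\<^sub>M x) (y \<bullet> \<psi>\<^sub>A (inv \<beta>\<^sub>A b)))"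
    by (intro bilin_comp[OF K] bilin_left[OF bilin_mult] linear_\<alpha>\<^sub>M)
  have H1: "bilin sA sM sM (\<lambda>x y. H (\<alpha>\<^sub>A x) (y \<lhd> \<psi>\<^sub>A (inv \<beta>\<^sub>A b)))"
    by (intro bilin_comp[OF H] bilin_left[OF bilin_actr] linear_\<alpha>)
  have "sw\<^sub>\<phi> (\<lambda>x y. (x \<triangleleft> a) \<triangleleft> y) (m \<triangleleft> b) = slift sM (\<lambda>(x, y). K x y) (\<phi> (inv \<alpha>\<^sub>M m \<lhd> inv \<beta>\<^sub>A b))"
    by (simp add: sw_def K_def untwist_def)
  also have "\<dots> = slift sM (\<lambda>(x, y). K (\<omega>\<^sub>M (inv \<alpha>\<^sub>M m) \<lhd> x) (\<beta>\<^sub>A y)) (\<Delta> (inv \<beta>\<^sub>A b))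
      + slift sM (\<lambda>(x, y). K (\<alpha>\<^sub>M x) (y \<bullet> \<psi>\<^sub>A (inv \<beta>\<^sub>A b))) (\<phi> (inv \<alpha>\<^sub>M m))
      + sM l (K (\<alpha>\<^sub>M (\<omega>\<^sub>M (inv \<alpha>\<^sub>M m))) (\<beta>\<^sub>A (\<psi>\<^sub>A (inv \<beta>\<^sub>A b))))"
    unfolding \<phi>_actr slift_qadd[OF bilin_annihilates[OF K]] slift_qscale[OF bilin_annihilates[OF K]]
      slift_sext_tens2[OF K] slift_tens2[OF K] ..
  also have "slift sM (\<lambda>(x, y). K (\<omega>\<^sub>M (inv \<alpha>\<^sub>M m) \<lhd> x) (\<beta>\<^sub>A y)) (\<Delta> (inv \<beta>\<^sub>A b))
      = sw\<^sub>\<Delta> (\<lambda>x y. m \<triangleleft> ((x \<cdot> a) \<cdot> y)) b"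
    unfolding slift_inv_comult[where F = \<Delta> and e = \<beta>\<^sub>A, OF \<beta>_comult bij_\<beta> bij_\<beta> bij_\<beta> linear_\<beta> linear_\<beta> K1]
    unfolding sw_def K_def ract_ract
    by (simp add: simps_H)
  also have "\<dots> = m \<triangleleft> (a \<circ>\<^sub>A b)"
    unfolding self.circ_def by (rule sw_linear_comp[symmetric, OF bilin_right[OF bilin_ract]])
  also have "slift sM (\<lambda>(x, y). K (\<alpha>\<^sub>M x) (y \<bullet> \<psi>\<^sub>A (inv \<beta>\<^sub>A b))) (\<phi> (inv \<alpha>\<^sub>M m))
      = sw\<^sub>\<phi> (\<lambda>x y. ((x \<triangleleft> a) \<triangleleft> y) \<triangleleft> b) m"
    unfolding slift_inv_comult[where F = \<phi> and e = \<alpha>\<^sub>M, OF \<alpha>\<^sub>M_\<phi> bij_\<alpha>\<^sub>M bij_\<alpha>\<^sub>M bij_\<alpha> linear_\<alpha>\<^sub>M linear_\<alpha> K2]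
    \<comment> \<open>The instance keeps \<open>x \<triangleleft> a\<close> intact as the module
      element, so that only \<open>y\<close> and \<open>b\<close> are merged into a product.\<close>
    unfolding sw_def K_def ract_ract[of "n \<triangleleft> a" for n, symmetric]
    by (simp add: simps_H)
  also have "\<dots> = sw\<^sub>\<phi> (\<lambda>x y. (x \<triangleleft> a) \<triangleleft> y) m \<triangleleft> b"
    by (rule sw_linear_comp[symmetric, OF bilin_left[OF bilin_ract]])
  also have "K (\<alpha>\<^sub>M (\<omega>\<^sub>M (inv \<alpha>\<^sub>M m))) (\<beta>\<^sub>A (\<psi>\<^sub>A (inv \<beta>\<^sub>A b))) = (m \<triangleleft> a) \<triangleleft> b"
    by (simp add: K_def commute_A cancel_A commute_H cancel_H)
  finally have R: "sw\<^sub>\<phi> (\<lambda>x y. (x \<triangleleft> a) \<triangleleft> y) (m \<triangleleft> b)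
    = m \<triangleleft> (a \<circ>\<^sub>A b) + sw\<^sub>\<phi> (\<lambda>x y. (x \<triangleleft> a) \<triangleleft> y) m \<triangleleft> b + sM l ((m \<triangleleft> a) \<triangleleft> b)" .
  have "sw\<^sub>\<rho> (\<lambda>x y. (x \<cdot> a) \<triangleright> y) (m \<triangleleft> b) = slift sM (\<lambda>(x, y). H x y) (\<rho> (inv \<alpha>\<^sub>M m \<lhd> inv \<beta>\<^sub>A b))"
    by (simp add: sw_def H_def untwist_def)
  also have "\<dots> = slift sM (\<lambda>(x, y). H (\<alpha>\<^sub>A x) (y \<lhd> \<psi>\<^sub>A (inv \<beta>\<^sub>A b))) (\<rho> (inv \<alpha>\<^sub>M m))"
    unfolding \<rho>_actr slift_sext_tens2[OF H] ..
  also have "\<dots> = sw\<^sub>\<rho> (\<lambda>x y. ((x \<cdot> a) \<triangleright> y) \<triangleleft> b) m"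
    unfolding slift_inv_comult[where F = \<rho> and e = \<alpha>\<^sub>M, OF \<alpha>\<^sub>M_\<rho> bij_\<alpha>\<^sub>M bij_\<alpha> bij_\<alpha>\<^sub>M linear_\<alpha> linear_\<alpha>\<^sub>M H1]
    unfolding sw_def H_def lact_ract[symmetric]
    by (simp add: simps_H)
  also have "\<dots> = sw\<^sub>\<rho> (\<lambda>x y. (x \<cdot> a) \<triangleright> y) m \<triangleleft> b"
    by (rule sw_linear_comp[symmetric, OF bilin_left[OF bilin_ract]])
  finally show ?thesis
    unfolding circl_def R by (simp add: ract_add add_ac)
qed

section \<open>Iterated coactions and the pre-Lie identities on M\<close>

lemma sw_coassoc_\<rho>\<rho>:
  assumes "\<And>y z. Vector_Spaces.linear sA sM (\<lambda>x. t x y z)"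
      "\<And>x z. Vector_Spaces.linear sA sM (\<lambda>y. t x y z)"
      "\<And>x y. Vector_Spaces.linear sM sM (\<lambda>z. t x y z)"
  shows "sw\<^sub>\<rho> (\<lambda>x y. sw\<^sub>\<Delta> (\<lambda>u v. t u v y) x) m = sw\<^sub>\<rho> (\<lambda>x y. sw\<^sub>\<rho> (\<lambda>u v. t x u v) y) m"
  by (rule sw_coassoc[where F = \<Delta> and G = \<rho> and t = t and \<omega>\<^sub>P = \<omega>\<^sub>A and \<omega>\<^sub>Q = \<omega>\<^sub>A and \<omega>\<^sub>X = \<omega>\<^sub>A
        and \<psi>\<^sub>Q = \<psi>\<^sub>A and \<psi>\<^sub>R = \<psi>\<^sub>M and \<psi>\<^sub>Y = \<psi>\<^sub>M, OF \<rho>_\<rho>[symmetric] \<omega>_comult \<psi>\<^sub>M_\<rho>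
        bij_\<omega> bij_\<omega> bij_\<omega> bij_\<psi> bij_\<psi>\<^sub>M bij_\<psi>\<^sub>M \<psi>_\<omega> linear_\<omega> linear_\<omega> linear_\<psi> linear_\<psi>\<^sub>M assms])

lemma sw_coassoc_\<phi>\<phi>:
  assumes "\<And>y z. Vector_Spaces.linear sM sM (\<lambda>x. t x y z)"
      "\<And>x z. Vector_Spaces.linear sA sM (\<lambda>y. t x y z)"
      "\<And>x y. Vector_Spaces.linear sA sM (\<lambda>z. t x y z)"
  shows "sw\<^sub>\<phi> (\<lambda>x y. sw\<^sub>\<phi> (\<lambda>u v. t u v y) x) m = sw\<^sub>\<phi> (\<lambda>x y. sw\<^sub>\<Delta> (\<lambda>u v. t x u v) y) m"
  by (rule sw_coassoc[where F = \<phi> and G = \<Delta> and t = t and \<omega>\<^sub>P = \<omega>\<^sub>M and \<omega>\<^sub>Q = \<omega>\<^sub>A and \<omega>\<^sub>X = \<omega>\<^sub>M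
        and \<psi>\<^sub>Q = \<psi>\<^sub>A and \<psi>\<^sub>R = \<psi>\<^sub>A and \<psi>\<^sub>Y = \<psi>\<^sub>A, OF \<phi>_\<phi>[symmetric] \<omega>\<^sub>M_\<phi> \<psi>_comult
        bij_\<omega>\<^sub>M bij_\<omega> bij_\<omega>\<^sub>M bij_\<psi> bij_\<psi> bij_\<psi> \<psi>_\<omega> linear_\<omega>\<^sub>M linear_\<omega> linear_\<psi> linear_\<psi> assms])

lemma sw_coassoc_\<rho>\<phi>:
  assumes "\<And>y z. Vector_Spaces.linear sA sM (\<lambda>x. t x y z)"
      "\<And>x z. Vector_Spaces.linear sM sM (\<lambda>y. t x y z)"
      "\<And>x y. Vector_Spaces.linear sA sM (\<lambda>z. t x y z)"
  shows "sw\<^sub>\<phi> (\<lambda>x y. sw\<^sub>\<rho> (\<lambda>u v. t u v y) x) m = sw\<^sub>\<rho> (\<lambda>x y. sw\<^sub>\<phi> (\<lambda>u v. t x u v) y) m"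
  by (rule sw_coassoc[where F = \<rho> and G = \<phi> and t = t and \<omega>\<^sub>P = \<omega>\<^sub>A and \<omega>\<^sub>Q = \<omega>\<^sub>M and \<omega>\<^sub>X = \<omega>\<^sub>M
        and \<psi>\<^sub>Q = \<psi>\<^sub>M and \<psi>\<^sub>R = \<psi>\<^sub>A and \<psi>\<^sub>Y = \<psi>\<^sub>M, OF \<rho>_\<phi>[symmetric] \<omega>\<^sub>M_\<rho> \<psi>\<^sub>M_\<phi>
        bij_\<omega> bij_\<omega>\<^sub>M bij_\<omega>\<^sub>M bij_\<psi>\<^sub>M bij_\<psi> bij_\<psi>\<^sub>M \<psi>\<^sub>M_\<omega>\<^sub>M linear_\<omega> linear_\<omega>\<^sub>M linear_\<psi>\<^sub>M linear_\<psi> assms])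

text \<open>Both sides are m_1 b m_2 a m_3, summed over the three positions of the factor from M.
  The last, middle and first positions are matched by the axioms for \<rho> with \<rho>, \<rho> with
  \<phi>, and \<phi> with \<phi>.\<close>

lemma coassoc_circl:
  "sw\<^sub>\<rho> (\<lambda>x y. (x \<cdot> b) \<triangleright> circl a y) m + sw\<^sub>\<phi> (\<lambda>x y. (x \<triangleleft> b) \<triangleleft> (a \<circ>\<^sub>A y)) m
    = sw\<^sub>\<rho> (\<lambda>x y. ((b \<circ>\<^sub>A x) \<cdot> a) \<triangleright> y) m + sw\<^sub>\<phi> (\<lambda>x y. (circl b x \<triangleleft> a) \<triangleleft> y) m"
proof -
  have 1: "(x \<cdot> b) \<triangleright> circl a y = sw\<^sub>\<rho> (\<lambda>u v. (((x \<cdot> b) \<cdot> u) \<cdot> a) \<triangleright> v) y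
      + sw\<^sub>\<phi> (\<lambda>u v. (((x \<cdot> b) \<triangleright> u) \<triangleleft> a) \<triangleleft> v) y" for x y
    unfolding circl_def lact_add sw_linear_comp[OF bilin_right[OF bilin_lact]] lact_ract lact_lact mul_assoc ..
  have 2: "(x \<triangleleft> b) \<triangleleft> (a \<circ>\<^sub>A y) = sw\<^sub>\<Delta> (\<lambda>u v. (((x \<triangleleft> b) \<triangleleft> u) \<triangleleft> a) \<triangleleft> v) y" for x y
    unfolding self.circ_def sw_linear_comp[OF bilin_right[OF bilin_ract]] ract_ract ..
  have 3: "((b \<circ>\<^sub>A x) \<cdot> a) \<triangleright> y = sw\<^sub>\<Delta> (\<lambda>u v. (((u \<cdot> b) \<cdot> v) \<cdot> a) \<triangleright> y) x" for x y
    unfolding self.circ_def sw_linear_comp[OF bilin_left[OF bilin_mul]] sw_linear_comp[OF bilin_left[OF bilin_lact]] ..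
  have 4: "(circl b x \<triangleleft> a) \<triangleleft> y = sw\<^sub>\<rho> (\<lambda>u v. (((u \<cdot> b) \<triangleright> v) \<triangleleft> a) \<triangleleft> y) x
      + sw\<^sub>\<phi> (\<lambda>u v. (((u \<triangleleft> b) \<triangleleft> v) \<triangleleft> a) \<triangleleft> y) x" for x y
    unfolding circl_def ract_add sw_linear_comp[OF bilin_left[OF bilin_ract]] ..
  have "sw\<^sub>\<rho> (\<lambda>x y. sw\<^sub>\<Delta> (\<lambda>u v. (((u \<cdot> b) \<cdot> v) \<cdot> a) \<triangleright> y) x) m
      = sw\<^sub>\<rho> (\<lambda>x y. sw\<^sub>\<rho> (\<lambda>u v. (((x \<cdot> b) \<cdot> u) \<cdot> a) \<triangleright> v) y) m"
    by (rule sw_coassoc_\<rho>\<rho>) (intro linear_act)+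
  moreover have "sw\<^sub>\<phi> (\<lambda>x y. sw\<^sub>\<rho> (\<lambda>u v. (((u \<cdot> b) \<triangleright> v) \<triangleleft> a) \<triangleleft> y) x) m
      = sw\<^sub>\<rho> (\<lambda>x y. sw\<^sub>\<phi> (\<lambda>u v. (((x \<cdot> b) \<triangleright> u) \<triangleleft> a) \<triangleleft> v) y) m"
    by (rule sw_coassoc_\<rho>\<phi>) (intro linear_act)+
  moreover have "sw\<^sub>\<phi> (\<lambda>x y. sw\<^sub>\<phi> (\<lambda>u v. (((u \<triangleleft> b) \<triangleleft> v) \<triangleleft> a) \<triangleleft> y) x) m
      = sw\<^sub>\<phi> (\<lambda>x y. sw\<^sub>\<Delta> (\<lambda>u v. (((x \<triangleleft> b) \<triangleleft> u) \<triangleleft> a) \<triangleleft> v) y) m"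
    by (rule sw_coassoc_\<phi>\<phi>) (intro linear_act)+
  ultimately show ?thesis
    unfolding 1 2 3 4 sw_add[OF vector_space_M] by (simp add: add_ac)
qed

text \<open>The grouping is made for \<open>coassoc_circl\<close>, which turns the first bracket
  into the second with \<open>a\<close> and \<open>b\<close> exchanged. The \<lambda> bracket is
  symmetric as it stands.\<close>

lemma circl_circl:
  "circl a (circl b m) = circl (a \<circ>\<^sub>A b) m
    + (sw\<^sub>\<rho> (\<lambda>x y. (x \<cdot> b) \<triangleright> circl a y) m + sw\<^sub>\<phi> (\<lambda>x y. (x \<triangleleft> b) \<triangleleft> (a \<circ>\<^sub>A y)) m)
    + (sw\<^sub>\<rho> (\<lambda>x y. ((a \<circ>\<^sub>A x) \<cdot> b) \<triangleright> y) m + sw\<^sub>\<phi> (\<lambda>x y. (circl a x \<triangleleft> b) \<triangleleft> y) m)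
    + sM l (sw\<^sub>\<rho> (\<lambda>x y. ((x \<cdot> a) \<cdot> b) \<triangleright> y) m + sw\<^sub>\<rho> (\<lambda>x y. ((x \<cdot> b) \<cdot> a) \<triangleright> y) m
      + (sw\<^sub>\<phi> (\<lambda>x y. ((x \<triangleleft> a) \<triangleleft> b) \<triangleleft> y) m + sw\<^sub>\<phi> (\<lambda>x y. ((x \<triangleleft> b) \<triangleleft> a) \<triangleleft> y) m))"
proof -
  interpret M: vector_space sM by (rule vector_space_M)
  have "circl a (circl b m) = sw\<^sub>\<rho> (\<lambda>x y. circl a ((x \<cdot> b) \<triangleright> y)) m + sw\<^sub>\<phi> (\<lambda>x y. circl a ((x \<triangleleft> b) \<triangleleft> y)) m"
    unfolding circl_def[of b] linear_addD[OF bilin_right[OF bilin_circl]]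
      sw_linear_comp[OF bilin_right[OF bilin_circl]] ..
  then show ?thesis
    by (simp add: circl_lact circl_ract self.circ_mul lact_add lact_scale ract_add ract_scale
        sw_add[OF vector_space_M] sw_scale[OF vector_space_M] M.scale_right_distrib
        mul_assoc ract_ract circl_def[of "a \<circ>\<^sub>A b"] add_ac)
qed

lemma pre_lie_circl:
  "circl a (circl b m) - circl (a \<circ>\<^sub>A b) m = circl b (circl a m) - circl (b \<circ>\<^sub>A a) m"
  unfolding circl_circl coassoc_circl by (simp add: algebra_simps)

text \<open>\<open>circl a\<close> passes through c_1 m c_2 by \<open>circl_lact\<close> and
  \<open>circl_ract\<close>, acting on each factor in turn.\<close>

lemma circl_circ:
  "circl a (circ m c) = circ (circl a m) c + sw\<^sub>\<Delta> (\<lambda>x y. ((a \<circ>\<^sub>A x) \<triangleright> m) \<triangleleft> y) c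
    + sw\<^sub>\<Delta> (\<lambda>x y. (x \<triangleright> m) \<triangleleft> (a \<circ>\<^sub>A y)) c
    + sM l (sw\<^sub>\<Delta> (\<lambda>x y. ((x \<cdot> a) \<triangleright> m) \<triangleleft> y) c + sw\<^sub>\<Delta> (\<lambda>x y. ((x \<triangleright> m) \<triangleleft> a) \<triangleleft> y) c)"
proof -
  interpret M: vector_space sM by (rule vector_space_M)
  have "circl a (circ m c) = sw\<^sub>\<Delta> (\<lambda>x y. circl a ((x \<triangleright> m) \<triangleleft> y)) c"
    unfolding circ_def by (rule sw_linear_comp[OF bilin_right[OF bilin_circl]])
  then show ?thesis
    by (simp add: circl_lact circl_ract ract_add ract_scale sw_add[OF vector_space_M] sw_scale[OF vector_space_M]
        M.scale_right_distrib circ_def[of "circl a m"] add_ac)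
qed

text \<open>The \<lambda> terms of \<open>circl_circ\<close> and \<open>circ_circ_A\<close>
  coincide, and the two coassociativity lemmas identify (a \<circ> c_1) m c_2 with c_1 a (m \<circ>
  c_2) and c_1 m (a \<circ> c_2) with (m \<circ> c_1) a c_2.\<close>

lemma pre_lie_circl_circ:
  "circl a (circ m c) - circ (circl a m) c = circ m (a \<circ>\<^sub>A c) - circ (circ m a) c"
  unfolding circl_circ circ_circ_A coassoc_lact_circ coassoc_ract_circ by (simp add: algebra_simps)

section \<open>Return from the untwisted to the BiHom operations\<close>

lemmas sw_\<alpha>_\<rho> = sw_comult[where F = \<rho> and e = \<alpha>\<^sub>M and a = \<alpha>\<^sub>A and b = \<alpha>\<^sub>M and f = \<omega>\<^sub>A and g = \<psi>\<^sub>M,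
    OF \<alpha>\<^sub>M_\<rho> bij_\<omega> bij_\<psi>\<^sub>M bij_\<alpha> bij_\<alpha>\<^sub>M \<alpha>_\<omega> \<alpha>\<^sub>M_\<psi>\<^sub>M linear_\<omega> linear_\<psi>\<^sub>M]
  and sw_\<alpha>_\<phi> = sw_comult[where F = \<phi> and e = \<alpha>\<^sub>M and a = \<alpha>\<^sub>M and b = \<alpha>\<^sub>A and f = \<omega>\<^sub>M and g = \<psi>\<^sub>A,
    OF \<alpha>\<^sub>M_\<phi> bij_\<omega>\<^sub>M bij_\<psi> bij_\<alpha>\<^sub>M bij_\<alpha> \<alpha>\<^sub>M_\<omega>\<^sub>M \<alpha>_\<psi> linear_\<omega>\<^sub>M linear_\<psi>]
  and sw_\<beta>_\<rho> = sw_comult[where F = \<rho> and e = \<beta>\<^sub>M and a = \<beta>\<^sub>A and b = \<beta>\<^sub>M and f = \<omega>\<^sub>A and g = \<psi>\<^sub>M,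
    OF \<beta>\<^sub>M_\<rho> bij_\<omega> bij_\<psi>\<^sub>M bij_\<beta> bij_\<beta>\<^sub>M \<beta>_\<omega> \<beta>\<^sub>M_\<psi>\<^sub>M linear_\<omega> linear_\<psi>\<^sub>M]
  and sw_\<beta>_\<phi> = sw_comult[where F = \<phi> and e = \<beta>\<^sub>M and a = \<beta>\<^sub>M and b = \<beta>\<^sub>A and f = \<omega>\<^sub>M and g = \<psi>\<^sub>A,
    OF \<beta>\<^sub>M_\<phi> bij_\<omega>\<^sub>M bij_\<psi> bij_\<beta>\<^sub>M bij_\<beta> \<beta>\<^sub>M_\<omega>\<^sub>M \<beta>_\<psi> linear_\<omega>\<^sub>M linear_\<psi>]

lemma \<alpha>\<^sub>M_circl: "\<alpha>\<^sub>M (circl a m) = circl (\<alpha>\<^sub>A a) (\<alpha>\<^sub>M m)"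
  unfolding circl_def linear_addD[OF linear_\<alpha>\<^sub>M] sw_linear_comp[OF linear_\<alpha>\<^sub>M] \<alpha>\<^sub>M_ract \<alpha>\<^sub>M_lact \<alpha>_mul
  by (subst sw_\<alpha>_\<rho> sw_\<alpha>_\<phi>, intro bilinI linear_act)+ (rule refl)

lemma \<beta>\<^sub>M_circl: "\<beta>\<^sub>M (circl a m) = circl (\<beta>\<^sub>A a) (\<beta>\<^sub>M m)"
  unfolding circl_def linear_addD[OF linear_\<beta>\<^sub>M] sw_linear_comp[OF linear_\<beta>\<^sub>M] \<beta>\<^sub>M_ract \<beta>\<^sub>M_lact \<beta>_mul
  by (subst sw_\<beta>_\<rho> sw_\<beta>_\<phi>, intro bilinI linear_act)+ (rule refl)

text \<open>As in \<open>star_circ\<close>, two untwistings cancel \<alpha>^-2 on the first leg and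
  turn \<beta>^-1(a) into \<alpha>(a). The \<beta> left on both legs of each coaction is that of
  \<beta>(m).\<close>

lemma star_circl:
  "slift sM (\<lambda>(m1, m0). (inv \<alpha>\<^sub>A (inv \<alpha>\<^sub>A (\<beta>\<^sub>A (inv \<omega>\<^sub>A m1))) \<bullet> inv \<beta>\<^sub>A a) \<rhd> inv \<psi>\<^sub>M m0) (\<rho> m)
    + slift sM (\<lambda>(m0, m1). (inv \<alpha>\<^sub>M (inv \<alpha>\<^sub>M (\<beta>\<^sub>M (inv \<omega>\<^sub>M m0))) \<lhd> inv \<beta>\<^sub>A a) \<lhd> inv \<psi>\<^sub>A m1) (\<phi> m)
    = circl (\<alpha>\<^sub>A a) (\<beta>\<^sub>M m)" (is "?L = _")
proof -
  have "?L = sw\<^sub>\<rho> (\<lambda>x y. (\<beta>\<^sub>A x \<cdot> \<alpha>\<^sub>A a) \<triangleright> \<beta>\<^sub>M y) m + sw\<^sub>\<phi> (\<lambda>x y. (\<beta>\<^sub>M x \<triangleleft> \<alpha>\<^sub>A a) \<triangleleft> \<beta>\<^sub>A y) m"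
    by (simp add: sw_def simps_H)
  also have "\<dots> = circl (\<alpha>\<^sub>A a) (\<beta>\<^sub>M m)"
    unfolding circl_def
    by (subst sw_\<beta>_\<rho> sw_\<beta>_\<phi>, intro bilinI linear_act)+ (rule refl)
  finally show ?thesis .
qed

text \<open>Pushing \<alpha> and \<beta> inwards turns each BiHom identity into the ordinary one,
  with the first two arguments under \<alpha>^2 \<beta> and the last one under \<beta>^2.\<close>

theorem bihom_pre_lie_bimodule_circ:
  "bihom_pre_lie_bimodule sA (\<lambda>a b. \<alpha>\<^sub>A a \<circ>\<^sub>A \<beta>\<^sub>A b) \<alpha>\<^sub>A \<beta>\<^sub>A sM
    (\<lambda>a m. circl (\<alpha>\<^sub>A a) (\<beta>\<^sub>M m)) (\<lambda>m a. circ (\<alpha>\<^sub>M m) (\<beta>\<^sub>A a)) \<alpha>\<^sub>M \<beta>\<^sub>M"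
proof (intro bihom_pre_lie_bimodule.intro bihom_pre_lie_algebra.intro bihom_pre_lie_bimodule_axioms.intro)
  note simps = self.\<alpha>\<^sub>M_circ self.\<beta>\<^sub>M_circ \<alpha>\<^sub>M_circ \<beta>\<^sub>M_circ \<alpha>\<^sub>M_circl \<beta>\<^sub>M_circl \<alpha>_\<beta> \<alpha>\<^sub>M_\<beta>\<^sub>M
  fix a b c :: 'a and m :: 'm
  show "\<alpha>\<^sub>A (\<alpha>\<^sub>A (\<beta>\<^sub>A a)) \<circ>\<^sub>A \<beta>\<^sub>A (\<alpha>\<^sub>A (\<alpha>\<^sub>A b) \<circ>\<^sub>A \<beta>\<^sub>A c) - \<alpha>\<^sub>A (\<alpha>\<^sub>A (\<beta>\<^sub>A a) \<circ>\<^sub>A \<beta>\<^sub>A (\<alpha>\<^sub>A b)) \<circ>\<^sub>A \<beta>\<^sub>A (\<beta>\<^sub>A c)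
      = \<alpha>\<^sub>A (\<alpha>\<^sub>A (\<beta>\<^sub>A b)) \<circ>\<^sub>A \<beta>\<^sub>A (\<alpha>\<^sub>A (\<alpha>\<^sub>A a) \<circ>\<^sub>A \<beta>\<^sub>A c) - \<alpha>\<^sub>A (\<alpha>\<^sub>A (\<beta>\<^sub>A b) \<circ>\<^sub>A \<beta>\<^sub>A (\<alpha>\<^sub>A a)) \<circ>\<^sub>A \<beta>\<^sub>A (\<beta>\<^sub>A c)"
    unfolding simps by (rule pre_lie_circ)
  show "circl (\<alpha>\<^sub>A (\<alpha>\<^sub>A (\<beta>\<^sub>A a))) (\<beta>\<^sub>M (circl (\<alpha>\<^sub>A (\<alpha>\<^sub>A b)) (\<beta>\<^sub>M m)))
        - circl (\<alpha>\<^sub>A (\<alpha>\<^sub>A (\<beta>\<^sub>A a) \<circ>\<^sub>A \<beta>\<^sub>A (\<alpha>\<^sub>A b))) (\<beta>\<^sub>M (\<beta>\<^sub>M m))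
      = circl (\<alpha>\<^sub>A (\<alpha>\<^sub>A (\<beta>\<^sub>A b))) (\<beta>\<^sub>M (circl (\<alpha>\<^sub>A (\<alpha>\<^sub>A a)) (\<beta>\<^sub>M m)))
        - circl (\<alpha>\<^sub>A (\<alpha>\<^sub>A (\<beta>\<^sub>A b) \<circ>\<^sub>A \<beta>\<^sub>A (\<alpha>\<^sub>A a))) (\<beta>\<^sub>M (\<beta>\<^sub>M m))"
    unfolding simps by (rule pre_lie_circl)
  show "circl (\<alpha>\<^sub>A (\<alpha>\<^sub>A (\<beta>\<^sub>A a))) (\<beta>\<^sub>M (circ (\<alpha>\<^sub>M (\<alpha>\<^sub>M m)) (\<beta>\<^sub>A c)))
        - circ (\<alpha>\<^sub>M (circl (\<alpha>\<^sub>A (\<beta>\<^sub>A a)) (\<beta>\<^sub>M (\<alpha>\<^sub>M m)))) (\<beta>\<^sub>A (\<beta>\<^sub>A c))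
      = circ (\<alpha>\<^sub>M (\<alpha>\<^sub>M (\<beta>\<^sub>M m))) (\<beta>\<^sub>A (\<alpha>\<^sub>A (\<alpha>\<^sub>A a) \<circ>\<^sub>A \<beta>\<^sub>A c))
        - circ (\<alpha>\<^sub>M (circ (\<alpha>\<^sub>M (\<beta>\<^sub>M m)) (\<beta>\<^sub>A (\<alpha>\<^sub>A a)))) (\<beta>\<^sub>A (\<beta>\<^sub>A c))"
    unfolding simps by (rule pre_lie_circl_circ)
qed (fact vector_space_A vector_space_M linear_\<alpha> linear_\<beta> linear_\<alpha>\<^sub>M linear_\<beta>\<^sub>M \<alpha>_\<beta> \<alpha>\<^sub>M_\<beta>\<^sub>M
  | rule bilin_comp[OF self.bilin_circ linear_\<alpha> linear_\<beta>] bilin_comp[OF bilin_circl linear_\<alpha> linear_\<beta>\<^sub>M]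
      bilin_comp[OF bilin_circ linear_\<alpha>\<^sub>M linear_\<beta>]
  | simp add: self.\<alpha>\<^sub>M_circ self.\<beta>\<^sub>M_circ \<alpha>\<^sub>M_circ \<beta>\<^sub>M_circ \<alpha>\<^sub>M_circl \<beta>\<^sub>M_circl \<alpha>_\<beta> \<alpha>\<^sub>M_\<beta>\<^sub>M)+

end

section \<open>The star operations in terms of the original structure maps\<close>

theorem proposition2p42:
  fixes l :: "'k::field"
    and sA :: "'k \<Rightarrow> 'a::ab_group_add \<Rightarrow> 'a"
    and \<mu> :: "'a \<Rightarrow> 'a \<Rightarrow> 'a" (infixl \<open>\<bullet>\<close> 70)
    and \<Delta> :: "'a \<Rightarrow> ('k, 'a \<times> 'a) coset"
    and \<alpha>\<^sub>A \<beta>\<^sub>A \<psi>\<^sub>A \<omega>\<^sub>A :: "'a \<Rightarrow> 'a"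
    and sM :: "'k \<Rightarrow> 'm::ab_group_add \<Rightarrow> 'm"
    and actl :: "'a \<Rightarrow> 'm \<Rightarrow> 'm" (infixr \<open>\<rhd>\<close> 70)
    and actr :: "'m \<Rightarrow> 'a \<Rightarrow> 'm" (infixl \<open>\<lhd>\<close> 70)
    and \<rho> :: "'m \<Rightarrow> ('k, 'a \<times> 'm) coset"
    and \<phi> :: "'m \<Rightarrow> ('k, 'm \<times> 'a) coset"
    and \<alpha>\<^sub>M \<beta>\<^sub>M \<psi>\<^sub>M \<omega>\<^sub>M :: "'m \<Rightarrow> 'm"
    and starA :: "'a \<Rightarrow> 'a \<Rightarrow> 'a"
    and starl :: "'a \<Rightarrow> 'm \<Rightarrow> 'm"
    and starr :: "'m \<Rightarrow> 'a \<Rightarrow> 'm"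
  assumes bialgebra: "infBH_bialgebra l sA \<mu> \<Delta> \<alpha>\<^sub>A \<beta>\<^sub>A \<psi>\<^sub>A \<omega>\<^sub>A"
    and bij_A: "bij \<alpha>\<^sub>A" "bij \<beta>\<^sub>A" "bij \<psi>\<^sub>A" "bij \<omega>\<^sub>A"
    and hopf_bimodule: "infBH_hopf_bimodule l sA \<mu> \<Delta> \<alpha>\<^sub>A \<beta>\<^sub>A \<psi>\<^sub>A \<omega>\<^sub>A
      sM actl actr \<rho> \<phi> \<alpha>\<^sub>M \<beta>\<^sub>M \<psi>\<^sub>M \<omega>\<^sub>M"
    and compatible: "hopf_bimodule_maps_compatible sA \<alpha>\<^sub>A \<beta>\<^sub>A \<psi>\<^sub>A \<omega>\<^sub>A
      sM actl actr \<rho> \<phi> \<alpha>\<^sub>M \<beta>\<^sub>M \<psi>\<^sub>M \<omega>\<^sub>M"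
    and bij_M: "bij \<alpha>\<^sub>M" "bij \<beta>\<^sub>M" "bij \<psi>\<^sub>M" "bij \<omega>\<^sub>M"
  defines "starl \<equiv> \<lambda>a m.
      slift sM (\<lambda>(m1, m0).
        (inv \<alpha>\<^sub>A (inv \<alpha>\<^sub>A (\<beta>\<^sub>A (inv \<omega>\<^sub>A m1))) \<bullet> inv \<beta>\<^sub>A a) \<rhd> inv \<psi>\<^sub>M m0) (\<rho> m)
    + slift sM (\<lambda>(m0, m1).
        (inv \<alpha>\<^sub>M (inv \<alpha>\<^sub>M (\<beta>\<^sub>M (inv \<omega>\<^sub>M m0))) \<lhd> inv \<beta>\<^sub>A a) \<lhd> inv \<psi>\<^sub>A m1) (\<phi> m)"
    and "starr \<equiv> \<lambda>m a.
      slift sM (\<lambda>(a1, a2).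
        (inv \<alpha>\<^sub>A (inv \<alpha>\<^sub>A (\<beta>\<^sub>A (inv \<omega>\<^sub>A a1))) \<rhd> inv \<beta>\<^sub>M m) \<lhd> inv \<psi>\<^sub>A a2) (\<Delta> a)"
    and "starA \<equiv> \<lambda>a b.
      slift sA (\<lambda>(b1, b2).
        (inv \<alpha>\<^sub>A (inv \<alpha>\<^sub>A (\<beta>\<^sub>A (inv \<omega>\<^sub>A b1))) \<bullet> inv \<beta>\<^sub>A a) \<bullet> inv \<psi>\<^sub>A b2) (\<Delta> b)"
  shows "bihom_pre_lie_bimodule sA starA \<alpha>\<^sub>A \<beta>\<^sub>A sM starl starr \<alpha>\<^sub>M \<beta>\<^sub>M"
proof -
  interpret bij_hopf_bimodule l sA \<mu> \<Delta> \<alpha>\<^sub>A \<beta>\<^sub>A \<psi>\<^sub>A \<omega>\<^sub>A sM actl actr \<rho> \<phi> \<alpha>\<^sub>M \<beta>\<^sub>M \<psi>\<^sub>M \<omega>\<^sub>M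
    using infBH_hopf_bimodule.axioms(2)[OF hopf_bimodule]
    by (intro bij_hopf_bimodule.intro bij_bimodule.intro bij_bialgebra.intro bij_bialgebra_axioms.intro
        bij_bimodule_axioms.intro bij_hopf_bimodule_axioms.intro
        bialgebra hopf_bimodule compatible bij_A bij_M)
  \<comment> \<open>One lemma treats both operations built from \<Delta>: \<open>star_circ\<close>
    on M, and its instance \<open>self.star_circ\<close> at M = A.\<close>
  show ?thesis
    unfolding starl_def starr_def starA_def star_circl star_circ self.star_circ
    by (rule bihom_pre_lie_bimodule_circ)
qed

end
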